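(* Let $r>0$ be an integer and $\underline{x}=(x_2,\ldots,x_r)$ a tuple of elements of $\{0,1\}$. The power series $\Phi_w\in 1+Y\mathbb{Z}[[X,Y]]$ for all $w\in\Gamma_{\underline{x}}$ are rational functions with the lowest common denominator $$D_{\underline{x}}\ :=\ (1-2Y)\cdot\prod_{1\le k\le r}D_{\underline{x},k}\ \in\ 1+Y\mathbb{Z}[X,Y].$$
   Context: Let $T$ be the infinite rooted regular binary tree whose vertices are the finite words over $\{0,1\}$, with root the empty word, each word $t$ being joined by an edge to the words $0t$ and $1t$. Level $n$ of $T$ is the set of words of length $n$. Let $W=\mathrm{Aut}(T)$ be the automorphism group of $T$ (products are compositions, $(uv)(t)=u(v(t))$), with identity element $1$. For $u,v\in W$, let $(u,v)\in W$ be the automorphism fixing the root and given by $t0\mapsto u(t)0$ and $t1\mapsto v(t)1$ for every word $t$. Let $\sigma\in W$ be the involution fixing the root with $t0\mapsto t1$ and $t1\mapsto t0$ for every word $t$. For $w\in W$, every orbit of $w$ on level $n$ has length $2^m$ for some $0\le m\le n$. The orbit length generating function of $w$ is $\Phi_w=\sum_{n\ge m\ge 0}o_{m,n}(w)X^mY^n$, where $o_{m,n}(w)$ is the number of orbits of $w$ of length $2^m$ on level $n$. Let $b_1,\ldots,b_r\in W$ be the elements determined by the recursion relations $b_1=(1,b_r)\,\sigma$; $b_i=(b_{i-1},1)$ for all $2\le i\le r$ with $x_i=0$; $b_i=(1,b_{i-1})$ for all $2\le i\le r$ with $x_i=1$. Let $\Gamma_{\underline{x}}\subset W$ be the subgroup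 generated by $b_1,\ldots,b_r$. Let $\pi$ be the permutation of $\{1,\ldots,r\}$ with $\pi(1)=r$ and $\pi(i)=i-1$ for $i>1$. Say that a subset $J\subset\{1,\ldots,r\}$ satisfies condition (C) if for every $n\ge0$ with $1\notin\pi^n(J)$, the values $x_i$ for all $i\in\pi^n(J)$ are equal. For a subset $J\subset\{1,\ldots,r\}$ with elements $i_1<\ldots<i_k$ set $$\Psi_J:=\frac{1}{1-X^kY^r}\cdot\sum_{1\le j\le k}X^{j-1}Y^{i_j}.$$ The lowest common denominator of a set $S$ of rational functions in $X,Y$ (having a common denominator) is the generator, up to sign, of the ideal $\{D\in\mathbb{Z}[X,Y] : D f\in\mathbb{Z}[X,Y]\ \text{for all } f\in S\}$; here it is normalized to lie in $1+Y\mathbb{Z}[X,Y]$ (and it is $1$ if $S$ is empty). For $1\le k\le r$, $D_{\underline{x},k}$ denotes the lowest common denominator of the $\Psi_J$ for all $J\subset\{1,\ldots,r\}$ with $|J|=k$ satisfying condition (C). *)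

theory Defs
  imports
    "HOL-Algebra.Generated_Groups"
    "HOL-Combinatorics.Orbits"
    "HOL-Computational_Algebra.Computational_Algebra"
begin

section \<open>The binary tree and its automorphism group\<close>

text \<open>
  The letters 0 and 1 are \<^const>\<open>False\<close> and \<^const>\<open>True\<close>. A word is written as a list
  from left to right, so the children of \<open>t\<close> are \<open>a # t\<close>, and the two subtrees hanging from
  the root are distinguished by the \<^emph>\<open>last\<close> letter of a word.
\<close>

type_synonym word = "bool list"

definition tree_adj :: "word \<Rightarrow> word \<Rightarrow> bool" where
  "tree_adj s t \<longleftrightarrow> (\<exists>a. s = a # t) \<or> (\<exists>a. t = a # s)"

definition tree_aut :: "(word \<Rightarrow> word) \<Rightarrow> bool" where
  "tree_aut f \<longleftrightarrow> bij f \<and> f [] = [] \<and> (\<forall>s t. tree_adj (f s) (f t) \<longleftrightarrow> tree_adj s t)"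

definition AutT :: "(word \<Rightarrow> word) monoid" where
  "AutT = \<lparr>carrier = {f. tree_aut f}, monoid.mult = (\<circ>), monoid.one = id\<rparr>"

definition tree_pair :: "(word \<Rightarrow> word) \<Rightarrow> (word \<Rightarrow> word) \<Rightarrow> word \<Rightarrow> word" where
  "tree_pair u v s =
     (if s = [] then [] else (if last s then v else u) (butlast s) @ [last s])"

definition tree_swap :: "word \<Rightarrow> word" where
  "tree_swap s = (if s = [] then [] else butlast s @ [\<not> last s])"

lemma tree_pair_simps [simp]:
  "tree_pair u v [] = []"
  "tree_pair u v (t @ [False]) = u t @ [False]"
  "tree_pair u v (t @ [True]) = v t @ [True]"
  by (simp_all add: tree_pair_def)

lemma tree_swap_simps [simp]:
  "tree_swap [] = []"
  "tree_swap (t @ [False]) = t @ [True]"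
  "tree_swap (t @ [True]) = t @ [False]"
  by (simp_all add: tree_swap_def)


section \<open>The generators and the group they generate\<close>

text \<open>
  The tuple \<open>(x\<^sub>2,\<dots>,x\<^sub>r)\<close> is a function on the naturals of which only the values at
  \<open>2,\<dots>,r\<close> are used.
\<close>

definition recursion_relations ::
  "nat \<Rightarrow> (nat \<Rightarrow> bool) \<Rightarrow> (nat \<Rightarrow> word \<Rightarrow> word) \<Rightarrow> bool" where
  "recursion_relations r x b \<longleftrightarrow>
     (\<forall>i\<in>{1..r}. b i \<in> carrier AutT) \<and>
     b 1 = tree_pair \<one>\<^bsub>AutT\<^esub> (b r) \<otimes>\<^bsub>AutT\<^esub> tree_swap \<and>
     (\<forall>i\<in>{2..r}. x i = False \<longrightarrow> b i = tree_pair (b (i - 1)) \<one>\<^bsub>AutT\<^esub>) \<and>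
     (\<forall>i\<in>{2..r}. x i = True \<longrightarrow> b i = tree_pair \<one>\<^bsub>AutT\<^esub> (b (i - 1)))"

definition Gamma :: "nat \<Rightarrow> (nat \<Rightarrow> word \<Rightarrow> word) \<Rightarrow> (word \<Rightarrow> word) set" where
  "Gamma r b = generate AutT (b ` {1..r})"


section \<open>Polynomials, rational functions and power series in two variables\<close>

text \<open>
  \<open>\<int>[X,Y]\<close> is \<open>\<int>[X][Y]\<close> and \<open>\<int>[[X,Y]]\<close> is \<open>\<int>[[X]][[Y]]\<close>: the outer variable is \<open>Y\<close>,
  the inner one is \<open>X\<close>.
\<close>

type_synonym poly2 = "int poly poly"
type_synonym ratfun2 = "int poly poly fract"
type_synonym fps2 = "int fps fps"

definition varX :: poly2 where "varX = [:[:0, 1:]:]"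
definition varY :: poly2 where "varY = [:0, 1:]"

definition one_plus_Y_poly :: "poly2 set" where
  "one_plus_Y_poly = {1 + varY * P | P. True}"

definition one_plus_Y_fps :: "fps2 set" where
  "one_plus_Y_fps = {1 + fps_X * F | F. True}"

definition rat_of_poly :: "poly2 \<Rightarrow> ratfun2" where
  "rat_of_poly P = Fract P 1"

definition fps_of_poly2 :: "poly2 \<Rightarrow> fps2" where
  "fps_of_poly2 P = fps_of_poly (map_poly fps_of_poly P)"

text \<open>\<open>F\<close> and \<open>f\<close> are the same element of the field of fractions of \<open>\<int>[[X,Y]]\<close>.\<close>

definition is_rational :: "fps2 \<Rightarrow> ratfun2 \<Rightarrow> bool" where
  "is_rational F f \<longleftrightarrow>
     (\<exists>N D. D \<noteq> 0 \<and> f = Fract N D \<and> fps_of_poly2 D * F = fps_of_poly2 N)"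

definition denominator_ideal :: "ratfun2 set \<Rightarrow> poly2 set" where
  "denominator_ideal S = {D. \<forall>f\<in>S. rat_of_poly D * f \<in> range rat_of_poly}"

definition is_lcd :: "ratfun2 set \<Rightarrow> poly2 \<Rightarrow> bool" where
  "is_lcd S D \<longleftrightarrow> D \<in> one_plus_Y_poly \<and> denominator_ideal S = {D * Q | Q. True}"

definition lcd :: "ratfun2 set \<Rightarrow> poly2" where
  "lcd S = (THE D. is_lcd S D)"


section \<open>Orbit length generating functions\<close>

definition orbit_count :: "(word \<Rightarrow> word) \<Rightarrow> nat \<Rightarrow> nat \<Rightarrow> nat" where
  "orbit_count w m n = card {B. (\<exists>t. length t = n \<and> B = orbit w t) \<and> card B = 2 ^ m}"

definition Phi :: "(word \<Rightarrow> word) \<Rightarrow> fps2" where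
  "Phi w = Abs_fps (\<lambda>n. Abs_fps (\<lambda>m. if m \<le> n then int (orbit_count w m n) else 0))"


section \<open>The denominators\<close>

definition cyc :: "nat \<Rightarrow> nat \<Rightarrow> nat" where
  "cyc r i = (if i = 1 then r else i - 1)"

definition condition_C :: "nat \<Rightarrow> (nat \<Rightarrow> bool) \<Rightarrow> nat set \<Rightarrow> bool" where
  "condition_C r x J \<longleftrightarrow>
     (\<forall>n. 1 \<notin> (cyc r ^^ n) ` J \<longrightarrow>
        (\<forall>i\<in>(cyc r ^^ n) ` J. \<forall>j\<in>(cyc r ^^ n) ` J. x i = x j))"

definition Psi :: "nat \<Rightarrow> nat set \<Rightarrow> ratfun2" where
  "Psi r J =
     Fract (\<Sum>j = 1..card J. varX ^ (j - 1) * varY ^ (sorted_list_of_set J ! (j - 1)))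
           (1 - varX ^ card J * varY ^ r)"

definition Dk :: "nat \<Rightarrow> (nat \<Rightarrow> bool) \<Rightarrow> nat \<Rightarrow> poly2" where
  "Dk r x k = lcd {Psi r J | J. J \<subseteq> {1..r} \<and> card J = k \<and> condition_C r x J}"

definition Dx :: "nat \<Rightarrow> (nat \<Rightarrow> bool) \<Rightarrow> poly2" where
  "Dx r x = (1 - 2 * varY) * (\<Prod>k = 1..r. Dk r x k)"


section \<open>The notions are well defined\<close>

lemma tree_autI:
  assumes "bij f" "f [] = []" and tl: "\<And>t. f (tl t) = tl (f t)"
  shows "tree_aut f"
proof -
  have inj: "f s = f t \<longleftrightarrow> s = t" for s t
    using \<open>bij f\<close> by (simp add: bij_is_inj inj_eq)
  have ch: "(\<exists>a. s = a # t) \<longleftrightarrow> s \<noteq> [] \<and> tl s = t" for s t :: word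
    by (cases s) auto
  have "f s = [] \<longleftrightarrow> s = []" for s
    using inj[of s "[]"] \<open>f [] = []\<close> by simp
  then have "(\<exists>a. f s = a # f t) \<longleftrightarrow> (\<exists>a. s = a # t)" for s t
    unfolding ch by (simp add: tl[symmetric] inj)
  then show ?thesis
    using assms(1,2) by (simp add: tree_aut_def tree_adj_def)
qed

lemma group_AutT: "group AutT"
proof (rule groupI)
  fix f assume "f \<in> carrier AutT"
  then have f: "bij f" "f [] = []" "\<And>s t. tree_adj (f s) (f t) \<longleftrightarrow> tree_adj s t"
    by (auto simp: AutT_def tree_aut_def)
  define g where "g = inv_into UNIV f"
  have fg: "f (g s) = s" and gf: "g (f s) = s" for s
    using f(1) by (simp_all add: g_def bij_is_surj surj_f_inv_f bij_is_inj inv_f_f)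
  have "tree_aut g"
    unfolding tree_aut_def
    using f fg gf by (metis bij_imp_bij_inv g_def)
  moreover have "g \<circ> f = id"
    by (auto simp: gf)
  ultimately show "\<exists>g\<in>carrier AutT. g \<otimes>\<^bsub>AutT\<^esub> f = \<one>\<^bsub>AutT\<^esub>"
    by (auto simp: AutT_def)
qed (auto simp: AutT_def tree_aut_def intro: bij_comp)

lemma word_snoc_cases: "t = [] \<or> (\<exists>s. t = s @ [False]) \<or> (\<exists>s. t = s @ [True])"
proof (cases t rule: rev_cases)
  case (snoc s a)
  then show ?thesis by (cases a) auto
qed simp

lemma tree_swap_in_AutT: "tree_swap \<in> carrier AutT"
proof -
  have "tree_swap (tree_swap t) = t" for t
    using word_snoc_cases[of t] by auto
  then have "bij tree_swap"
    by (intro o_bij[of tree_swap]) auto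
  moreover have "tree_swap (tl t) = tl (tree_swap t)" for t
    using word_snoc_cases[of t] by (auto simp: tl_append split: list.splits)
  ultimately show ?thesis
    by (auto simp: AutT_def intro: tree_autI)
qed

text \<open>The generators acting on reversed words, where the recursion becomes structural.\<close>

primrec rev_gen :: "nat \<Rightarrow> (nat \<Rightarrow> bool) \<Rightarrow> word \<Rightarrow> nat \<Rightarrow> word" where
  "rev_gen r x [] i = []"
| "rev_gen r x (c # s) i =
     (if i = 1 then (\<not> c) # (if c then s else rev_gen r x s r)
      else c # (if c = x i then rev_gen r x s (i - 1) else s))"

definition tree_gen :: "nat \<Rightarrow> (nat \<Rightarrow> bool) \<Rightarrow> nat \<Rightarrow> word \<Rightarrow> word" where
  "tree_gen r x i t = rev (rev_gen r x (rev t) i)"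

lemma rev_gen_inj: "rev_gen r x s i = rev_gen r x t i \<Longrightarrow> s = t"
proof (induction s arbitrary: t i)
  case Nil
  then show ?case by (cases t) (auto split: if_splits)
next
  case (Cons c s)
  then obtain d t' where "t = d # t'"
    by (cases t) (auto split: if_splits)
  with Cons show ?case
    by (auto split: if_splits)
qed

lemma rev_gen_surj: "\<exists>s. rev_gen r x s i = t"
proof (induction t arbitrary: i)
  case Nil
  then show ?case by (intro exI[of _ "[]"]) simp
next
  case (Cons c t)
  obtain u where u: "rev_gen r x u r = t" using Cons by blast
  obtain v where v: "rev_gen r x v (i - 1) = t" using Cons by blast
  have "rev_gen r x ((if i = 1 then \<not> c else c) #
      (if i = 1 then (if c then u else t) else if c = x i then v else t)) i = c # t"
    using u v by auto
  then show ?case by blast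
qed

lemma rev_gen_butlast: "rev_gen r x (butlast s) i = butlast (rev_gen r x s i)"
proof (induction s arbitrary: i)
  case (Cons c s)
  have "rev_gen r x s j = [] \<longleftrightarrow> s = []" for j
    using rev_gen_inj[of r x s j "[]"] by auto
  with Cons show ?case by auto
qed simp

lemma tree_gen_in_AutT: "tree_gen r x i \<in> carrier AutT"
proof -
  have "inj (tree_gen r x i)"
    by (auto simp: inj_def tree_gen_def dest: rev_gen_inj)
  moreover have "\<exists>s. t = tree_gen r x i s" for t
    using rev_gen_surj[of r x i "rev t"] unfolding tree_gen_def
    by (metis rev_rev_ident)
  ultimately have "bij (tree_gen r x i)"
    by (auto simp: bij_def surj_def)
  moreover have "tree_gen r x i (tl t) = tl (tree_gen r x i t)" for t
  proof -
    have "rev (tl t) = butlast (rev t)" by (simp add: butlast_rev)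
    then show ?thesis
      by (simp add: tree_gen_def rev_gen_butlast flip: butlast_rev)
         (metis butlast_rev rev_rev_ident)
  qed
  ultimately show ?thesis
    by (auto simp: AutT_def tree_gen_def intro: tree_autI)
qed

lemma recursion_relations_exist: "recursion_relations r x (tree_gen r x)"
proof -
  have "tree_gen r x 1 = tree_pair id (tree_gen r x r) \<circ> tree_swap"
  proof
    fix t show "tree_gen r x 1 t = (tree_pair id (tree_gen r x r) \<circ> tree_swap) t"
      using word_snoc_cases[of t] by (auto simp: tree_gen_def)
  qed
  moreover have "tree_gen r x i = tree_pair (tree_gen r x (i - 1)) id"
    if "i \<in> {2..r}" "\<not> x i" for i
  proof
    fix t show "tree_gen r x i t = tree_pair (tree_gen r x (i - 1)) id t"
      using word_snoc_cases[of t] that by (auto simp: tree_gen_def)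
  qed
  moreover have "tree_gen r x i = tree_pair id (tree_gen r x (i - 1))"
    if "i \<in> {2..r}" "x i" for i
  proof
    fix t show "tree_gen r x i t = tree_pair id (tree_gen r x (i - 1)) t"
      using word_snoc_cases[of t] that by (auto simp: tree_gen_def)
  qed
  ultimately show ?thesis
    using tree_gen_in_AutT by (auto simp: recursion_relations_def AutT_def)
qed

lemma recursion_relations_unique:
  assumes "recursion_relations r x b" "i \<in> {1..r}"
  shows "b i = tree_gen r x i"
proof
  let ?c = "tree_gen r x"
  fix t
  show "b i t = ?c i t"
    using assms(2)
  proof (induction t arbitrary: i rule: rev_induct)
    case Nil
    then show ?case
      using assms(1) by (auto simp: recursion_relations_def AutT_def tree_aut_def tree_gen_def)
  next
    case (snoc a t)
    have rec: "b 1 = tree_pair id (b r) \<circ> tree_swap"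
      "\<And>i. i \<in> {2..r} \<Longrightarrow> \<not> x i \<Longrightarrow> b i = tree_pair (b (i - 1)) id"
      "\<And>i. i \<in> {2..r} \<Longrightarrow> x i \<Longrightarrow> b i = tree_pair id (b (i - 1))"
      using assms(1) by (auto simp: recursion_relations_def AutT_def)
    have crec: "?c 1 = tree_pair id (?c r) \<circ> tree_swap"
      "\<And>i. i \<in> {2..r} \<Longrightarrow> \<not> x i \<Longrightarrow> ?c i = tree_pair (?c (i - 1)) id"
      "\<And>i. i \<in> {2..r} \<Longrightarrow> x i \<Longrightarrow> ?c i = tree_pair id (?c (i - 1))"
      using recursion_relations_exist[of r x] by (auto simp: recursion_relations_def AutT_def)
    show ?case
    proof (cases "i = 1")
      case True
      have "b r t = ?c r t" using snoc by (intro snoc.IH) auto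
      then show ?thesis unfolding True rec(1) crec(1) by (cases a) auto
    next
      case False
      with snoc.prems have i: "i \<in> {2..r}" by auto
      then have "b (i - 1) t = ?c (i - 1) t" by (intro snoc.IH) auto
      then show ?thesis
        using rec(2,3)[OF i] crec(2,3)[OF i] by (cases a; cases "x i") auto
    qed
  qed
qed

lemma one_plus_Y_poly_iff: "D \<in> one_plus_Y_poly \<longleftrightarrow> coeff D 0 = 1"
proof
  assume "coeff D 0 = 1"
  then obtain P where "D = pCons 1 P" by (cases D) auto
  then have "D = 1 + varY * P" by (simp add: varY_def poly_eq_iff coeff_pCons split: nat.split)
  then show "D \<in> one_plus_Y_poly" unfolding one_plus_Y_poly_def by blast
qed (auto simp: one_plus_Y_poly_def varY_def)

lemma is_lcd_unique:
  assumes "is_lcd S D" "is_lcd S E"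
  shows "D = E"
proof -
  have eq: "{D * Q | Q. True} = {E * Q | Q. True}"
    using assms by (simp add: is_lcd_def)
  have "D * 1 \<in> {E * Q | Q. True}" unfolding eq[symmetric] by blast
  then have "E dvd D" by auto
  have "E * 1 \<in> {D * Q | Q. True}" unfolding eq by blast
  then have "D dvd E" by auto
  with \<open>E dvd D\<close> obtain P Q where P: "D = E * P" and Q: "E = D * Q"
    unfolding dvd_def by blast
  have c: "coeff D 0 = 1" "coeff E 0 = 1"
    using assms by (auto simp: is_lcd_def one_plus_Y_poly_iff)
  then have "D \<noteq> 0" by auto
  with P Q have "P * Q = 1" by (metis mult.assoc mult_cancel_left1 mult.commute)
  then have "degree P = 0"
    by (metis dvd_triv_left is_unit_iff_degree is_unit_poly_iff degree_pCons_0)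
  then obtain p where "P = [:p:]" by (rule degree_eq_zeroE)
  moreover have "coeff P 0 = 1"
    using arg_cong[OF P, of "\<lambda>D. coeff D 0"] c by (simp add: coeff_mult)
  ultimately have "P = 1" by (simp add: one_pCons)
  with P show ?thesis by simp
qed

lemma is_lcd_exists:
  assumes "D0 \<in> one_plus_Y_poly" "D0 \<in> denominator_ideal S"
  shows "\<exists>D. is_lcd S D"
proof -
  have den: "D \<in> denominator_ideal S \<longleftrightarrow>
      (\<forall>a c. c \<noteq> 0 \<longrightarrow> Fract a c \<in> S \<longrightarrow> c dvd D * a)" for D
  proof -
    have "rat_of_poly D * Fract a c \<in> range rat_of_poly \<longleftrightarrow> c dvd D * a" if "c \<noteq> 0" for a c
      using that by (auto simp: rat_of_poly_def eq_fract mult.commute dvd_def image_iff)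
    then show ?thesis
      unfolding denominator_ideal_def mem_Collect_eq by (metis Fract_cases)
  qed
  have gcd: "gcd D E \<in> denominator_ideal S"
    if "D \<in> denominator_ideal S" "E \<in> denominator_ideal S" for D E
    using that unfolding den
    by (metis dvd_mult_unit_iff gcd_greatest gcd_mult_right dvd_normalize_iff normalize_mult
        mult.commute gcd_mult_distrib)
  define good where "good D \<longleftrightarrow> D \<noteq> 0 \<and> D \<in> denominator_ideal S" for D
  have "good D0" using assms by (auto simp: good_def one_plus_Y_poly_iff)
  then obtain D where D: "good D"
    and min: "\<And>E. good E \<Longrightarrow> size (prime_factorization D) \<le> size (prime_factorization E)"
    using ex_has_least_nat[of good D0 "\<lambda>D. size (prime_factorization D)"] by auto
  have dvd: "D dvd E" if "E \<in> denominator_ideal S" for E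
  proof -
    let ?G = "gcd D E"
    have G: "good ?G" using gcd D that by (auto simp: good_def)
    then have "prime_factorization ?G \<subseteq># prime_factorization D"
      using D by (simp add: good_def prime_factorization_subset_iff_dvd)
    with min[OF G] have "prime_factorization ?G = prime_factorization D"
      by (metis mset_subset_size subset_mset.le_neq_trans not_le)
    then have "normalize ?G = normalize D"
      using D G by (metis good_def prime_factorization_unique)
    then show ?thesis by (metis associated_iff_dvd gcd_dvd2 dvd_trans)
  qed
  have ideal: "D * Q \<in> denominator_ideal S" for Q
    using D by (auto simp: good_def den) (metis dvd_mult2 mult.assoc mult.commute)
  obtain Q where Q: "D0 = D * Q" using dvd[OF assms(2)] by (auto elim: dvdE)
  have "coeff D 0 * coeff Q 0 = 1"
    using assms(1) by (simp add: Q one_plus_Y_poly_iff coeff_mult)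
  then have unit: "coeff D 0 dvd 1" by (metis dvd_triv_left)
  then obtain c where c: "coeff D 0 * c = 1" by (auto elim: dvdE)
  let ?D = "D * [:c:]"
  have "?D \<in> one_plus_Y_poly"
    using c by (simp add: one_plus_Y_poly_iff mult.commute)
  moreover have "denominator_ideal S = {?D * P | P. True}"
  proof (intro equalityI subsetI)
    fix E assume "E \<in> denominator_ideal S"
    then obtain P where "E = D * P" using dvd by (auto elim: dvdE)
    moreover have "[:c * coeff D 0:] = 1"
      by (subst mult.commute) (simp only: c pCons_one)
    ultimately have "E = D * ([:c * coeff D 0:] * P)" by simp
    also have "[:c * coeff D 0:] = [:c:] * [:coeff D 0:]" by simp
    finally have "E = ?D * ([:coeff D 0:] * P)" by (simp only: mult.assoc)
    then show "E \<in> {?D * P | P. True}" by blast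
  qed (use ideal in \<open>auto simp: mult.assoc simp del: mult_pCons_right mult_pCons_left\<close>)
  ultimately show ?thesis unfolding is_lcd_def by blast
qed

lemma is_lcd_Dk:
  assumes "r > 0"
  shows "is_lcd {Psi r J | J. J \<subseteq> {1..r} \<and> card J = k \<and> condition_C r x J} (Dk r x k)"
proof -
  let ?S = "{Psi r J | J. J \<subseteq> {1..r} \<and> card J = k \<and> condition_C r x J}"
  let ?D0 = "1 - varX ^ k * varY ^ r"
  have c: "coeff ?D0 0 = 1"
    using assms by (simp add: coeff_mult varY_def coeff_0_power)
  then have "?D0 \<noteq> 0" by auto
  then have "?D0 \<in> denominator_ideal ?S"
    by (auto simp: denominator_ideal_def Psi_def rat_of_poly_def image_iff eq_fract)
  with c have "\<exists>D. is_lcd ?S D"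
    by (intro is_lcd_exists) (auto simp: one_plus_Y_poly_iff)
  then have "\<exists>!D. is_lcd ?S D" using is_lcd_unique by blast
  then show ?thesis unfolding Dk_def lcd_def by (rule theI')
qed

end

(*
  Write w as a word in the letters b_i and their inverses. Passing to the sections of w (or of
  its square, if w swaps the two subtrees) does not increase the length of the word, and Phi_w is
  an explicit affine combination of the series of the sections. In a word of minimal length among
  those whose series is not killed by D_x, no descendant ever gets shorter. The key point is that
  in such a word no letter occurs a positive even number of times: its occurrences would have to
  alternate with their inverses and separate the other letters into two classes, and following
  these classes through one period shows that the letter, seen as a marked point of a tree of
  Hubbard type in critical value position, is an endpoint, so that one class is empty and the word
  cancels. Hence Phi_w depends only on the set J of letters of odd multiplicity, J satisfies (C),
  and (1 - 2Y) Phi_w = 1 + (X - 2) Psi_J, a contradiction. Conversely the product of the b_i with i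
  in J realizes this series for every J satisfying (C), and 1 - X^k Y^r is coprime to X - 2 and to
  1 - X^m Y^r for m distinct from k.
*)

theory Submission
  imports Defs
begin

section \<open>Orbits on the levels of the tree\<close>

text \<open>Orbit counting uses only that the map permutes each level, for which injectivity
  suffices because levels are finite. The tree structure enters later through equations for
  \<open>f (c # s)\<close>.\<close>

definition level_perm :: "(word \<Rightarrow> word) \<Rightarrow> bool" where
  "level_perm f \<longleftrightarrow> inj f \<and> (\<forall>s. length (f s) = length s)"

lemma finite_level: "finite {s :: word. length s = n}"
  using finite_lists_length_eq[of "UNIV :: bool set" n] by simp

lemma card_level: "card {s :: word. length s = n} = 2 ^ n"
  using card_lists_length_eq[of "UNIV :: bool set" n] by simp

lemma level_perm_comp: "level_perm f \<Longrightarrow> level_perm g \<Longrightarrow> level_perm (f \<circ> g)"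
  by (auto simp: level_perm_def inj_compose)

lemma level_perm_bij:
  assumes "level_perm f"
  shows "bij f"
proof -
  have "\<exists>s. t = f s" for t
  proof -
    let ?L = "{s. length s = length t}"
    have "f ` ?L \<subseteq> ?L" "inj_on f ?L"
      using assms inj_on_subset[OF _ subset_UNIV] by (auto simp: level_perm_def)
    then have "f ` ?L = ?L" by (intro endo_inj_surj finite_level)
    moreover have "t \<in> ?L" by simp
    ultimately show ?thesis by blast
  qed
  then show ?thesis using assms by (auto simp: level_perm_def bij_def surj_def)
qed

lemma length_orbit:
  assumes "level_perm f" "s \<in> orbit f t"
  shows "length s = length t"
  using assms(2,1) by induction (auto simp: level_perm_def)

lemma orbit_subset_level: "level_perm f \<Longrightarrow> orbit f t \<subseteq> {s. length s = length t}"
  using length_orbit by blast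

lemma self_in_orbit:
  assumes "level_perm f"
  shows "s \<in> orbit f s"
proof -
  have "finite {y. \<exists>n. y = (f ^^ n) s}"
  proof (rule finite_subset)
    have "length ((f ^^ n) s) = length s" for n
      using assms by (induction n) (auto simp: level_perm_def)
    then show "{y. \<exists>n. y = (f ^^ n) s} \<subseteq> {t. length t = length s}" by auto
  qed (rule finite_level)
  moreover have "inj f" using assms by (simp add: level_perm_def)
  ultimately obtain n where "n > 0" "(f ^^ n) s = s"
    using funpow_inj_finite[of f s] by blast
  then show ?thesis unfolding orbit_altdef by force
qed

lemma finite_orbit_level: "level_perm f \<Longrightarrow> finite (orbit f s)"
  using finite_subset[OF orbit_subset_level finite_level] .

definition level_orbits :: "(word \<Rightarrow> word) \<Rightarrow> nat \<Rightarrow> word set set" where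
  "level_orbits f n = orbit f ` {t. length t = n}"

lemma finite_level_orbits: "finite (level_orbits f n)"
  by (simp add: level_orbits_def finite_level)

lemma orbit_count_altdef: "orbit_count f m n = card {B \<in> level_orbits f n. card B = 2 ^ m}"
  unfolding orbit_count_def level_orbits_def by (rule arg_cong[of _ _ card]) auto

text \<open>An orbit on level n has at most 2^n elements, so the cutoff at m \<le> n in
  \<open>Phi\<close> removes nothing.\<close>

lemma Phi_nth:
  assumes "level_perm f"
  shows "Phi f $ n $ m = int (orbit_count f m n)"
proof (cases "m \<le> n")
  case False
  have "card B \<noteq> 2 ^ m" if "B \<in> level_orbits f n" for B
  proof -
    have "B \<subseteq> {s. length s = n}"
      using that orbit_subset_level[OF assms] by (auto simp: level_orbits_def)
    then have "card B \<le> 2 ^ n" using card_mono[OF finite_level] card_level by metis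
    also have "(2 ^ n :: nat) < 2 ^ m" using False by simp
    finally show ?thesis by simp
  qed
  then have "{B \<in> level_orbits f n. card B = 2 ^ m} = {}" by blast
  then have "orbit_count f m n = 0" by (metis orbit_count_altdef card.empty)
  with False show ?thesis by (simp add: Phi_def)
qed (simp add: Phi_def)

section \<open>Conjugation invariance of the orbit series\<close>

lemma image_Collect_filter: "{y \<in> f ` A. P y} = f ` {x \<in> A. P (f x)}"
  by blast

lemma inj_on_image_sets: "inj h \<Longrightarrow> inj_on ((`) h) A"
  by (rule inj_onI) (simp add: inj_image_eq_iff)

lemma orbit_count_conj:
  assumes h: "inj h" "\<And>s. length (h s) = length s" "\<And>t. \<exists>s. t = h s"
    and gh: "\<And>s. g (h s) = h (f s)"
  shows "orbit_count g m n = orbit_count f m n"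
proof -
  have orb: "orbit g (h s) = h ` orbit f s" for s
  proof -
    have "(g ^^ k) (h s) = h ((f ^^ k) s)" for k by (induction k) (simp_all add: gh)
    then show ?thesis unfolding orbit_altdef by auto
  qed
  have "{t :: word. length t = n} = h ` {s. length s = n}"
  proof (intro equalityI subsetI)
    fix t :: word assume "t \<in> {t. length t = n}"
    moreover obtain s where "t = h s" using h(3) by blast
    ultimately show "t \<in> h ` {s. length s = n}" by (simp add: h(2))
  qed (auto simp: h(2))
  then have "level_orbits g n = orbit g ` h ` {s. length s = n}"
    unfolding level_orbits_def by (rule arg_cong)
  then have "level_orbits g n = (`) h ` level_orbits f n"
    by (simp only: image_image orb level_orbits_def)
  then have "{B \<in> level_orbits g n. card B = 2 ^ m} =
      (`) h ` {B \<in> level_orbits f n. card B = 2 ^ m}"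
    by (simp only: image_Collect_filter card_image[OF inj_on_subset[OF h(1) subset_UNIV]])
  then show ?thesis
    by (simp only: orbit_count_altdef card_image[OF inj_on_image_sets[OF h(1)]])
qed

text \<open>The conjugator may be any level-preserving bijection: below it is a word in the
  generators, or the reversal \<open>rev\<close> that exchanges the two conventions for tree
  words.\<close>

lemma Phi_conj:
  assumes "inj h" "\<And>s. length (h s) = length s" "\<And>t. \<exists>s. t = h s"
    and "\<And>s. g (h s) = h (f s)"
  shows "Phi g = Phi f"
proof -
  have "orbit_count g = orbit_count f"
    by (intro ext, rule orbit_count_conj[of h]) (rule assms)+
  then show ?thesis by (simp add: Phi_def cong: if_cong)
qed

section \<open>Recursion of the orbit series along the two subtrees\<close>

lemma Phi_nth_0:
  assumes "level_perm f"
  shows "Phi f $ 0 = 1"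
proof -
  have "orbit f [] \<subseteq> {[]}"
    using orbit_subset_level[OF assms, of "[]"] by simp
  with orbit_nonempty[of f "[]"] have "orbit f [] = {[]}" by blast
  moreover have "{t :: word. length t = 0} = {[]}" by simp
  ultimately have lev: "level_orbits f 0 = {{[]}}" by (simp only: level_orbits_def image_insert image_empty)
  have "orbit_count f m 0 = (if m = 0 then 1 else 0)" for m
  proof -
    have "{B \<in> level_orbits f 0. card B = 2 ^ m} = (if m = 0 then {{[]}} else {})"
      unfolding lev by (cases m) auto
    then show ?thesis by (simp add: orbit_count_altdef)
  qed
  then show ?thesis by (intro fps_ext) (simp add: Phi_nth[OF assms])
qed

text \<open>Each orbit below the root stays inside one subtree, so a level carries the disjoint
  union of the orbits of the two sections one level up, with the same lengths. The summand 1 is the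
  root.\<close>

lemma Phi_fix_children:
  assumes u: "\<And>c. level_perm (u c)" and f: "f [] = []" "\<And>c s. f (c # s) = c # u c s"
  shows "level_perm f" "Phi f = 1 + fps_X * (Phi (u False) + Phi (u True))"
proof -
  have u_eq: "u c a = u c b \<longleftrightarrow> a = b" and u_len: "length (u c a) = length a" for c a b
    using u[of c] by (simp_all add: level_perm_def inj_eq)
  show lp: "level_perm f"
    unfolding level_perm_def
  proof safe
    show "inj f"
    proof (rule injI)
      fix s t assume "f s = f t"
      then show "s = t"
        by (cases s; cases t) (auto simp: f u_eq)
    qed
    show "length (f s) = length s" for s
      by (cases s) (simp_all add: f u_len)
  qed
  have orb: "orbit f (c # s) = (#) c ` orbit (u c) s" for c s
  proof -
    have "(f ^^ k) (c # s) = c # (u c ^^ k) s" for k by (induction k) (simp_all add: f)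
    then show ?thesis unfolding orbit_altdef by auto
  qed
  have lev: "level_orbits f (Suc n) =
      (`) ((#) False) ` level_orbits (u False) n \<union> (`) ((#) True) ` level_orbits (u True) n" for n
  proof -
    have "{t :: word. length t = Suc n} =
        (#) False ` {s. length s = n} \<union> (#) True ` {s. length s = n}"
      by (auto simp: length_Suc_conv image_iff)
    then show ?thesis by (simp add: level_orbits_def image_Un image_image orb)
  qed
  have "orbit_count f m (Suc n) = orbit_count (u False) m n + orbit_count (u True) m n" for m n
  proof -
    let ?S = "\<lambda>c. {B \<in> level_orbits (u c) n. card B = 2 ^ m}"
    have inj: "inj_on ((`) ((#) c)) A" for c :: bool and A
      by (rule inj_on_image_sets) simp
    have cd: "card ((#) c ` B) = card B" for c :: bool and B by (simp add: card_image)
    have "{B \<in> level_orbits f (Suc n). card B = 2 ^ m} =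
        (`) ((#) False) ` ?S False \<union> (`) ((#) True) ` ?S True"
    proof -
      have "{B \<in> X \<union> Y. P B} = {B \<in> X. P B} \<union> {B \<in> Y. P B}" for X Y :: "word set set" and P
        by blast
      then show ?thesis by (simp only: lev image_Collect_filter cd)
    qed
    moreover have "(`) ((#) False) ` ?S False \<inter> (`) ((#) True) ` ?S True = {}"
    proof -
      have ne: "B \<noteq> {}" if "B \<in> level_orbits g n" for B g
        using that by (auto simp: level_orbits_def orbit_nonempty)
      show ?thesis
      proof (rule equals0I)
        fix D assume "D \<in> (`) ((#) False) ` ?S False \<inter> (`) ((#) True) ` ?S True"
        then obtain B C where "D = (#) False ` B" "D = (#) True ` C" "B \<in> level_orbits (u False) n"
          by blast
        with ne[of B "u False"] show False by auto
      qed
    qed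
    ultimately show ?thesis
      by (simp add: orbit_count_altdef card_Un_disjoint finite_level_orbits card_image inj)
  qed
  then have step: "Phi f $ Suc n = Phi (u False) $ n + Phi (u True) $ n" for n
    by (intro fps_ext) (simp add: Phi_nth[OF lp] Phi_nth[OF u])
  show "Phi f = 1 + fps_X * (Phi (u False) + Phi (u True))"
  proof (rule fps_ext)
    show "Phi f $ n = (1 + fps_X * (Phi (u False) + Phi (u True))) $ n" for n
      by (cases n) (simp_all add: Phi_nth_0[OF lp] step)
  qed
qed

text \<open>Every orbit below the root alternates between the two subtrees. Its part in the subtree
  \<open>False\<close> is an orbit of the first return map \<open>u True \<circ> u False\<close> and
  has half its length; hence a factor X, and a factor Y for the level.\<close>

lemma Phi_swap_children:
  assumes u: "\<And>c. level_perm (u c)" and f: "f [] = []" "\<And>c s. f (c # s) = (\<not> c) # u c s"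
  shows "level_perm f"
    "Phi f = 1 + fps_const fps_X * fps_X * Phi (u True \<circ> u False)"
proof -
  define g where "g = u True \<circ> u False"
  have g: "level_perm g" unfolding g_def by (intro level_perm_comp u)
  have u_eq: "u c a = u c b \<longleftrightarrow> a = b" and u_len: "length (u c a) = length a" for c a b
    using u[of c] by (simp_all add: level_perm_def inj_eq)
  show lp: "level_perm f"
    unfolding level_perm_def
  proof safe
    show "inj f"
    proof (rule injI)
      fix s t assume "f s = f t"
      then show "s = t"
        by (cases s; cases t) (auto simp: f u_eq)
    qed
    show "length (f s) = length s" for s
      by (cases s) (simp_all add: f u_len)
  qed
  have even: "(f ^^ (2 * k)) (False # s) = False # (g ^^ k) s" for k s
    by (induction k) (simp_all add: f g_def)
  have odd: "(f ^^ Suc (2 * k)) (False # s) = True # u False ((g ^^ k) s)" for k s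
    using even[of k s] by (simp add: f)
  have orb: "orbit f (False # s) =
      (#) False ` orbit g s \<union> (#) True ` u False ` orbit g s" (is "_ = ?R") for s
  proof
    show "orbit f (False # s) \<subseteq> ?R"
    proof
      fix t assume "t \<in> orbit f (False # s)"
      then obtain n where n: "n > 0" "t = (f ^^ n) (False # s)" by (auto simp: orbit_altdef)
      show "t \<in> ?R"
      proof (cases "even n")
        case True
        then obtain k where k: "n = 2 * k" by (auto elim: evenE)
        then have "t = False # (g ^^ k) s" "k > 0" using n even by auto
        then show ?thesis by (auto simp: orbit_altdef)
      next
        case False
        then obtain k where k: "n = Suc (2 * k)" by (auto elim: oddE)
        then have "t = True # u False ((g ^^ k) s)" using n odd by simp
        moreover have "(g ^^ k) s \<in> orbit g s"
          by (intro funpow_in_orbit self_in_orbit g)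
        ultimately show ?thesis by blast
      qed
    qed
    show "?R \<subseteq> orbit f (False # s)"
    proof -
      have "False # (g ^^ k) s \<in> orbit f (False # s)" for k
        using funpow_in_orbit[OF self_in_orbit[OF lp], of "2 * k" "False # s"]
        by (simp only: even)
      moreover have "True # u False ((g ^^ k) s) \<in> orbit f (False # s)" for k
        using funpow_in_orbit[OF self_in_orbit[OF lp], of "Suc (2 * k)" "False # s"]
        by (simp only: odd)
      ultimately show ?thesis by (auto simp: orbit_altdef)
    qed
  qed
  \<comment> \<open>\<open>F\<close> completes an orbit of the first return map to the whole orbit
    of \<open>f\<close>.\<close>
  define F where "F B = (#) False ` B \<union> (#) True ` u False ` B" for B
  have orbF: "orbit f (False # s) = F (orbit g s)" for s
    by (simp only: F_def orb)
  have inj: "inj_on F A" for A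
  proof (rule inj_onI)
    fix B C assume "F B = F C"
    then have "{s. False # s \<in> F B} = {s. False # s \<in> F C}" by simp
    then show "B = C" by (auto simp: F_def)
  qed
  have cardF: "card (F B) = 2 * card B" if "finite B" for B
  proof -
    have "inj_on (u False) B"
      using u[of False] inj_on_subset[OF _ subset_UNIV] by (auto simp: level_perm_def)
    then show ?thesis
      unfolding F_def using that
      by (subst card_Un_disjoint) (auto simp: card_image)
  qed
  have lev: "level_orbits f (Suc n) = F ` level_orbits g n" for n
  proof -
    have "orbit f t \<in> F ` level_orbits g n" if len: "length t = Suc n" for t
    proof -
      obtain c s where t: "t = c # s" "length s = n" using len by (cases t) auto
      \<comment> \<open>An orbit starting in the subtree \<open>True\<close> reaches the other one
        after one step, so it has a representative in the subtree \<open>False\<close>.\<close>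
      have ex: "\<exists>s'. length s' = n \<and> orbit f t = orbit f (False # s')"
      proof (cases c)
        case True
        then have "f t = False # u True s" by (simp add: t f)
        moreover have "orbit f (f t) = orbit f t"
          by (rule self_in_orbit_step[OF self_in_orbit[OF lp]])
        ultimately have "orbit f t = orbit f (False # u True s)" by simp
        moreover have "length (u True s) = n" using t by (simp add: u_len)
        ultimately show ?thesis by blast
      qed (use t in auto)
      then obtain s' where s': "length s' = n" "orbit f t = orbit f (False # s')" by blast
      then have "orbit g s' \<in> level_orbits g n" by (simp add: level_orbits_def)
      then have "F (orbit g s') \<in> F ` level_orbits g n" by (rule imageI)
      then show ?thesis by (simp only: s' orbF)
    qed
    moreover have "F (orbit g s) \<in> level_orbits f (Suc n)" if "length s = n" for s
    proof -
      have "orbit f (False # s) \<in> level_orbits f (Suc n)"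
        unfolding level_orbits_def by (rule imageI) (simp add: that)
      then show ?thesis by (simp add: orbF)
    qed
    ultimately show ?thesis
      unfolding level_orbits_def by (intro equalityI subsetI; elim imageE) simp_all
  qed
  have fin: "finite B" if "B \<in> level_orbits g n" for B n
    using that finite_orbit_level[OF g] by (auto simp: level_orbits_def)
  have cnt: "orbit_count f m (Suc n) = (case m of 0 \<Rightarrow> 0 | Suc k \<Rightarrow> orbit_count g k n)" for m n
  proof -
    have "{B \<in> level_orbits f (Suc n). card B = 2 ^ m} =
        F ` {B \<in> level_orbits g n. card (F B) = 2 ^ m}"
      unfolding lev by (rule image_Collect_filter)
    then have "orbit_count f m (Suc n) = card {B \<in> level_orbits g n. card (F B) = 2 ^ m}"
      unfolding orbit_count_altdef by (simp only: card_image[OF inj])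
    also have "\<dots> = card {B \<in> level_orbits g n. 2 * card B = 2 ^ m}"
      using cardF[OF fin] by (intro arg_cong[of _ _ card] Collect_cong conj_cong refl) simp
    also have "\<dots> = (case m of 0 \<Rightarrow> 0 | Suc k \<Rightarrow> orbit_count g k n)"
      by (cases m) (simp_all add: orbit_count_altdef)
    finally show ?thesis .
  qed
  have "Phi f $ n = (1 + fps_const fps_X * fps_X * Phi g) $ n" for n
  proof (cases n)
    case 0
    then show ?thesis by (simp add: Phi_nth_0[OF lp] mult.assoc)
  next
    case (Suc k)
    then have "(1 + fps_const fps_X * fps_X * Phi g) $ n = fps_X * Phi g $ k"
      by (simp add: mult.assoc)
    moreover have "Phi f $ n = fps_X * Phi g $ k"
      by (rule fps_ext) (simp add: Suc Phi_nth[OF lp] Phi_nth[OF g] cnt split: nat.split)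
    ultimately show ?thesis by simp
  qed
  then show "Phi f = 1 + fps_const fps_X * fps_X * Phi (u True \<circ> u False)"
    unfolding g_def by (rule fps_ext)
qed

section \<open>Words in the generators and their sections\<close>

type_synonym letter = "nat \<times> bool"

definition inv_letter :: "letter \<Rightarrow> letter" where
  "inv_letter a = (fst a, \<not> snd a)"

definition occ :: "nat \<Rightarrow> letter list \<Rightarrow> nat" where
  "occ i l = length (filter (\<lambda>a. fst a = i) l)"

lemma occ_simps [simp]:
  "occ i [] = 0"
  "occ i (a # l) = (if fst a = i then Suc (occ i l) else occ i l)"
  "occ i (l @ l') = occ i l + occ i l'"
  by (simp_all add: occ_def)

lemma occ_pos_iff: "occ i l > 0 \<longleftrightarrow> (\<exists>e. (i, e) \<in> set l)"
  by (induction l) auto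

text \<open>Cancellation across the two ends is included because the series of a word is invariant
  under conjugation.\<close>

definition cyc_reducible :: "letter list \<Rightarrow> bool" where
  "cyc_reducible l \<longleftrightarrow>
     (\<exists>l1 l2 a. l = l1 @ a # inv_letter a # l2 \<or> l = a # l1 @ [inv_letter a])"

text \<open>
  Paths in a graph with the two vertices \<open>False\<close> and \<open>True\<close>, in which the letter \<open>m\<close> is an edge
  from \<open>False\<close> to \<open>True\<close> and every other letter \<open>k\<close> is a loop at \<open>lab k\<close>.
\<close>

primrec path :: "nat \<Rightarrow> (nat \<Rightarrow> bool) \<Rightarrow> letter list \<Rightarrow> bool \<Rightarrow> bool \<Rightarrow> bool" where
  "path m lab [] v w \<longleftrightarrow> v = w"
| "path m lab (a # l) v w \<longleftrightarrow>
     (if fst a = m then v = (\<not> snd a) \<and> path m lab l (snd a) w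
      else v = lab (fst a) \<and> path m lab l v w)"

lemma path_append:
  "path m lab (l @ l') v w \<longleftrightarrow> (\<exists>u. path m lab l v u \<and> path m lab l' u w)"
  by (induction l arbitrary: v) auto

text \<open>With all loops at c, the only letter leaving c is \<open>(m, \<not> c)\<close>.\<close>

lemma path_avoiding:
  assumes "path m lab l c w" "(m, \<not> c) \<notin> set l" "\<And>a. a \<in> set l \<Longrightarrow> fst a \<noteq> m \<Longrightarrow> lab (fst a) = c"
  shows "w = c \<and> occ m l = 0"
  using assms
proof (induction l)
  case (Cons a l)
  have "fst a \<noteq> m"
  proof
    assume "fst a = m"
    with Cons.prems(1) have "c = (\<not> snd a)" by simp
    with \<open>fst a = m\<close> have "a = (m, \<not> c)" by (simp add: prod_eq_iff)
    with Cons.prems(2) show False by simp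
  qed
  moreover from this have "w = c \<and> occ m l = 0"
    using Cons.prems by (intro Cons.IH) simp_all
  ultimately show ?case by simp
qed simp

text \<open>There is no loop at the vertex other than c, so the edge back to c is forced.\<close>

lemma path_from_other:
  assumes "path m lab l (\<not> c) w" "\<And>a. a \<in> set l \<Longrightarrow> fst a \<noteq> m \<Longrightarrow> lab (fst a) = c" "l \<noteq> []"
  shows "\<exists>l'. l = (m, c) # l' \<and> path m lab l' c w"
proof -
  obtain a l' where l: "l = a # l'" using assms(3) by (cases l) auto
  have "fst a = m"
  proof (rule ccontr)
    assume "fst a \<noteq> m"
    moreover from this have "lab (fst a) = c" using assms(2)[of a] l by simp
    ultimately show False using assms(1) l by simp
  qed
  then have "snd a = c" "path m lab l' c w" using assms(1) l by auto
  with \<open>fst a = m\<close> l show ?thesis by (cases a) simp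
qed

text \<open>
  If all loops are at the same vertex, every visit to the other vertex is an immediate
  backtracking.
\<close>

lemma closed_path_reducible:
  assumes p: "path m lab l v v" and lab: "\<And>a. a \<in> set l \<Longrightarrow> fst a \<noteq> m \<Longrightarrow> lab (fst a) = c"
    and occ: "occ m l > 0"
  shows "cyc_reducible l"
proof (cases "(m, \<not> c) \<in> set l")
  case True
  then obtain l1 l2 where l: "l = l1 @ (m, \<not> c) # l2" using split_list by metis
  then obtain u where "path m lab ((m, \<not> c) # l2) u v" using p path_append by blast
  then have p2: "path m lab l2 (\<not> c) v" by simp
  show ?thesis
  proof (cases "l2 = []")
    case False
    then obtain l3 where "l2 = (m, c) # l3"
      using path_from_other[OF p2] lab l by auto
    then show ?thesis unfolding cyc_reducible_def inv_letter_def
      by (intro exI[of _ l1] exI[of _ l3] exI[of _ "(m, \<not> c)"]) (simp add: l)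
  next
    \<comment> \<open>The path ends away from c and, being closed, also starts there. Its forced
      first letter \<open>(m, c)\<close> cancels against the last letter across the ends.\<close>
    case True
    with p2 have "v = (\<not> c)" by simp
    then obtain l3 where "l = (m, c) # l3" using path_from_other[of m lab l c v] p lab l by auto
    moreover from this l True obtain l4 where "l3 = l4 @ [(m, \<not> c)]" by (cases l1) auto
    ultimately show ?thesis unfolding cyc_reducible_def inv_letter_def
      by (intro exI[of _ l4] exI[of _ "[]"] exI[of _ "(m, c)"]) simp
  qed
next
  case False
  show ?thesis
  proof (cases "v = c")
    case True
    then show ?thesis using path_avoiding[of m lab l c v] p False lab occ by auto
  next
    \<comment> \<open>A path starting away from c is forced to c and, without the departing letter,
      remains there, so it is not closed.\<close>
    case v: False
    then have "v = (\<not> c)" by simp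
    moreover have "l \<noteq> []" using occ by auto
    ultimately obtain l3 where l: "l = (m, c) # l3" "path m lab l3 c v"
      using path_from_other[of m lab l c v] p lab by auto
    then have "v = c" using path_avoiding[of m lab l3 c v] False lab by auto
    with v show ?thesis by simp
  qed
qed

section \<open>The action of words on the tree and their sections\<close>

locale kneading =
  fixes r :: nat and x :: "nat \<Rightarrow> bool"
  assumes r_pos: "r > 0"
begin

text \<open>
  Tree words are reversed here, so that the first letter selects the subtree at the root. On the
  subtree \<open>c\<close> the generator \<open>a\<close> acts as \<open>shift a\<close> if \<open>kept c a\<close> and trivially otherwise. A list of
  generators is read from left to right, the first one acting first.
\<close>

definition kept :: "bool \<Rightarrow> letter \<Rightarrow> bool" where
  "kept c a \<longleftrightarrow> (if fst a = 1 then c \<noteq> snd a else c = x (fst a))"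

definition shift :: "letter \<Rightarrow> letter" where
  "shift a = (cyc r (fst a), snd a)"

definition turn :: "bool \<Rightarrow> letter \<Rightarrow> bool" where
  "turn c a \<longleftrightarrow> c \<noteq> (fst a = 1)"

primrec act :: "word \<Rightarrow> letter \<Rightarrow> word" where
  "act [] a = []"
| "act (c # s) a = turn c a # (if kept c a then act s (shift a) else s)"

lemma length_act: "length (act s a) = length s"
  by (induction s arbitrary: a) auto

lemma act_inv: "act (act s a) (inv_letter a) = s"
proof (induction s arbitrary: a)
  case (Cons c s)
  have "turn (turn c a) (inv_letter a) = c" "kept (turn c a) (inv_letter a) = kept c a"
    "shift (inv_letter a) = inv_letter (shift a)"
    by (auto simp: turn_def kept_def inv_letter_def shift_def)
  then show ?case by (simp add: Cons.IH)
qed simp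

lemma level_perm_act: "level_perm (\<lambda>s. act s a)"
  unfolding level_perm_def
proof (intro conjI allI injI)
  fix s t assume "act s a = act t a"
  then show "s = t" by (metis act_inv)
qed (rule length_act)

primrec run :: "letter list \<Rightarrow> word \<Rightarrow> word" where
  "run [] s = s"
| "run (a # l) s = run l (act s a)"

lemma run_append: "run (l @ l') s = run l' (run l s)"
  by (induction l arbitrary: s) auto

lemma run_Nil_word: "run l [] = []"
  by (induction l) auto

lemma level_perm_run: "level_perm (run l)"
proof (induction l)
  case Nil
  then show ?case by (simp add: level_perm_def inj_def)
next
  case (Cons a l)
  have "run (a # l) = run l \<circ> (\<lambda>s. act s a)" by (simp add: fun_eq_iff)
  then show ?case using level_perm_comp[OF Cons.IH level_perm_act[of a]] by (simp only:)
qed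

primrec target :: "letter list \<Rightarrow> bool \<Rightarrow> bool" where
  "target [] c = c"
| "target (a # l) c = target l (turn c a)"

text \<open>No cancellation is performed here, so that lengths and letter counts are exact: each
  letter of a word survives in exactly one of the two sections.\<close>

primrec sec :: "letter list \<Rightarrow> bool \<Rightarrow> letter list" where
  "sec [] c = []"
| "sec (a # l) c = (if kept c a then shift a # sec l (turn c a) else sec l (turn c a))"

lemma run_Cons_word: "run l (c # s) = target l c # run (sec l c) s"
  by (induction l arbitrary: c s) auto

lemma target_eq: "target l c \<longleftrightarrow> c \<noteq> odd (occ 1 l)"
  by (induction l arbitrary: c) (auto simp: turn_def)

definition series :: "letter list \<Rightarrow> fps2" where
  "series l = Phi (run l)"

lemma series_nth_0: "series l $ 0 = 1"
  unfolding series_def by (rule Phi_nth_0[OF level_perm_run])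

lemma series_even:
  assumes "even (occ 1 l)"
  shows "series l = 1 + fps_X * (series (sec l False) + series (sec l True))"
  unfolding series_def
proof (rule Phi_fix_children(2))
  show "run l (c # s) = c # run (sec l c) s" for c s
    using assms by (simp add: run_Cons_word target_eq)
qed (simp_all add: level_perm_run run_Nil_word)

text \<open>The first return map to the subtree \<open>False\<close> runs through the section at
  \<open>False\<close> first and then through that at \<open>True\<close>, whence the order of
  concatenation.\<close>

lemma series_odd:
  assumes "odd (occ 1 l)"
  shows "series l = 1 + fps_const fps_X * fps_X * series (sec l False @ sec l True)"
proof -
  have "run (sec l False @ sec l True) = run (sec l True) \<circ> run (sec l False)"
    by (simp add: fun_eq_iff run_append)
  moreover have "Phi (run l) =
      1 + fps_const fps_X * fps_X * Phi (run (sec l True) \<circ> run (sec l False))"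
  proof (rule Phi_swap_children(2)[of "\<lambda>c. run (sec l c)"])
    show "run l (c # s) = (\<not> c) # run (sec l c) s" for c s
      using assms by (simp add: run_Cons_word target_eq)
  qed (simp_all add: level_perm_run run_Nil_word)
  ultimately show ?thesis by (simp add: series_def)
qed

text \<open>The two words are conjugate by \<open>run l'\<close>.\<close>

lemma series_rotate: "series (l @ l') = series (l' @ l)"
  unfolding series_def
proof (rule Phi_conj[of "run l'"])
  show "inj (run l')" "length (run l' s) = length s" for s
    using level_perm_run[of l'] by (simp_all add: level_perm_def)
  show "\<exists>s. t = run l' s" for t
    using bij_is_surj[OF level_perm_bij[OF level_perm_run]] by (rule surjD)
qed (simp add: run_append)

lemma series_cancel: "series (l1 @ a # inv_letter a # l2) = series (l1 @ l2)"
proof -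
  have "run (l1 @ a # inv_letter a # l2) = run (l1 @ l2)"
    by (simp add: fun_eq_iff run_append act_inv)
  then show ?thesis by (simp add: series_def)
qed

lemma cyc_reducible_shorter:
  assumes "cyc_reducible l"
  shows "\<exists>l'. length l' < length l \<and> set l' \<subseteq> set l \<and> series l' = series l"
proof -
  obtain l1 l2 a where "l = l1 @ a # inv_letter a # l2 \<or> l = a # l1 @ [inv_letter a]"
    using assms by (auto simp: cyc_reducible_def)
  then show ?thesis
  proof
    assume l: "l = l1 @ a # inv_letter a # l2"
    then show ?thesis by (intro exI[of _ "l1 @ l2"]) (auto simp: series_cancel)
  next
    assume l: "l = a # l1 @ [inv_letter a]"
    have ii: "inv_letter (inv_letter a) = a" by (simp add: inv_letter_def)
    \<comment> \<open>Rotating the last letter to the front makes the cancelling pair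
      adjacent.\<close>
    have "series l = series ([inv_letter a] @ a # l1)"
      unfolding l using series_rotate[of "a # l1" "[inv_letter a]"] by simp
    also have "\<dots> = series l1"
      using series_cancel[of "[]" "inv_letter a" l1] by (simp add: ii)
    finally show ?thesis by (intro exI[of _ l1]) (auto simp: l)
  qed
qed

definition letters :: "letter set" where
  "letters = {1..r} \<times> UNIV"

lemma cyc_in: "i \<in> {1..r} \<Longrightarrow> cyc r i \<in> {1..r}"
  by (auto simp: cyc_def)

lemma cyc_inj: "inj_on (cyc r) {1..r}"
  by (auto simp: cyc_def inj_on_def)

lemma shift_in: "a \<in> letters \<Longrightarrow> shift a \<in> letters"
  using cyc_in by (auto simp: letters_def shift_def)

lemma sec_in: "set l \<subseteq> letters \<Longrightarrow> set (sec l c) \<subseteq> letters"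
  by (induction l arbitrary: c) (auto simp: shift_in)

lemma turn_Not: "turn (\<not> c) a = (\<not> turn c a)"
  by (auto simp: turn_def)

lemma kept_Not: "kept (\<not> c) a = (\<not> kept c a)"
  by (auto simp: kept_def)

lemma length_sec: "length (sec l c) + length (sec l (\<not> c)) = length l"
  by (induction l arbitrary: c) (auto simp: turn_Not kept_Not)

lemma occ_sec:
  assumes "i \<in> {1..r}" "set l \<subseteq> letters"
  shows "occ (cyc r i) (sec l c) + occ (cyc r i) (sec l (\<not> c)) = occ i l"
  using assms(2)
proof (induction l arbitrary: c)
  case (Cons a l)
  have "fst a \<in> {1..r}" using Cons.prems by (auto simp: letters_def)
  then have "cyc r (fst a) = cyc r i \<longleftrightarrow> fst a = i"
    using inj_on_eq_iff[OF cyc_inj] assms(1) by blast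
  moreover have "occ (cyc r i) (sec l (turn c a)) + occ (cyc r i) (sec l (\<not> turn c a)) = occ i l"
    using Cons by simp
  ultimately show ?case by (auto simp: turn_Not kept_Not shift_def)
qed simp

section \<open>Separations of letters carried through the sections\<close>

text \<open>
  While the letter \<open>1\<close> becomes \<open>r\<close>, \<open>r - 1\<close>, \<open>\<dots>\<close>, the map \<open>lab n\<close> records for the
  instant at which it is \<open>r - n\<close> on which side of it the other letters lie.
\<close>

primrec lab :: "nat \<Rightarrow> nat \<Rightarrow> bool" where
  "lab 0 = (\<lambda>k. x (k + 1))"
| "lab (Suc n) = (\<lambda>k. if k \<noteq> r \<and> x (k + 1) = x (r - n) then lab n (k + 1) else lab n 1)"

text \<open>Since no letter is lost, every letter is read in the subtree where it acts nontrivially.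
  The vertex of the path is the current subtree: the letter 1, renamed r, crosses over, and a letter
  i > 1, renamed i - 1, is a loop at \<open>x i\<close>.\<close>

lemma path_sec_first:
  assumes "set l \<subseteq> letters" "length (sec l c) = length l"
  shows "path r (\<lambda>k. x (k + 1)) (sec l c) c (target l c)"
  using assms
proof (induction l arbitrary: c)
  case (Cons a l)
  have le: "length (sec l (turn c a)) \<le> length l"
    using length_sec[of l "turn c a"] by linarith
  then have k: "kept c a" using Cons.prems(2) by (auto split: if_splits)
  then have p: "path r (\<lambda>k. x (k + 1)) (sec l (turn c a)) (turn c a) (target l (turn c a))"
    using Cons.prems by (intro Cons.IH) auto
  have a: "1 \<le> fst a" "fst a \<le> r" using Cons.prems by (auto simp: letters_def)
  show ?case
  proof (cases "fst a = 1")
    case True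
    then have "c = (\<not> snd a)" "turn c a = snd a" "cyc r (fst a) = r"
      using k by (auto simp: kept_def turn_def cyc_def)
    then show ?thesis using k p by (simp add: shift_def)
  next
    case False
    then have "c = x (fst a)" "turn c a = c" "cyc r (fst a) = fst a - 1" "fst a - 1 \<noteq> r"
      "Suc (fst a - 1) = fst a"
      using k a by (auto simp: kept_def turn_def cyc_def)
    then show ?thesis using k p by (simp add: shift_def)
  qed
qed simp

text \<open>The path of the section follows that of \<open>l\<close> while the current subtree is
  \<open>x m\<close> and waits at \<open>h 1\<close> in the other one. The subtree changes only at
  the letter 1, a loop at \<open>h 1\<close>, so the two positions agree at every change. Letters
  kept during the waiting become loops at \<open>h 1\<close>.\<close>

lemma path_sec:
  assumes "set l \<subseteq> letters" "path m h l v w" and m: "1 < m" "m \<le> r"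
    and h': "h' r = h 1" "\<And>k. 1 < k \<Longrightarrow> k \<le> r \<Longrightarrow> h' (k - 1) = (if x k = x m then h k else h 1)"
  shows "path (m - 1) h' (sec l c)
    (if c = x m then v else h 1) (if target l c = x m then w else h 1)"
  using assms(1,2)
proof (induction l arbitrary: c v)
  case (Cons a l)
  have a: "1 \<le> fst a" "fst a \<le> r" and l: "set l \<subseteq> letters"
    using Cons.prems by (auto simp: letters_def)
  consider "fst a = 1" | "fst a = m" | "fst a \<noteq> 1" "fst a \<noteq> m" by blast
  then show ?case
  proof cases
    case 1
    then have v: "v = h 1" and p: "path m h l (h 1) w" using Cons.prems(2) m by auto
    have "cyc r (fst a) = r" "r \<noteq> m - 1" using 1 m by (auto simp: cyc_def)
    with Cons.IH[OF l p, of "turn c a"] show ?thesis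
      by (cases "c = x m"; cases "target l (turn c a) = x m") (simp_all add: v shift_def h'(1))
  next
    case 2
    then have v: "v = (\<not> snd a)" and p: "path m h l (snd a) w" using Cons.prems(2) by auto
    have "turn c a = c" "kept c a \<longleftrightarrow> c = x m" "cyc r (fst a) = m - 1"
      using 2 m by (auto simp: turn_def kept_def cyc_def)
    with Cons.IH[OF l p, of c] show ?thesis
      by (cases "c = x m") (simp_all add: v shift_def)
  next
    case 3
    then have v: "v = h (fst a)" and p: "path m h l v w" using Cons.prems(2) by auto
    have "turn c a = c" "kept c a \<longleftrightarrow> c = x (fst a)" "cyc r (fst a) = fst a - 1"
      "fst a - 1 \<noteq> m - 1"
      using 3 m a by (auto simp: turn_def kept_def cyc_def)
    moreover have "h' (fst a - 1) = (if x (fst a) = x m then v else h 1)"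
      using 3 a h'(2)[of "fst a"] v by simp
    ultimately show ?thesis using Cons.IH[OF l p, of c]
      by (cases "c = x (fst a)") (simp_all add: shift_def)
  qed
qed simp

subsection \<open>The critical value is an endpoint\<close>

text \<open>\<open>lab\<close> reindexed by the current index p of the marked letter. For the cyclic
  map sending q to q + 1 and r to 1, the point r is critical with critical value 1, and
  \<open>x (q + 1)\<close> tells on which side of the critical point q < r lies.\<close>

definition side :: "nat \<Rightarrow> nat \<Rightarrow> bool" where
  "side p = lab (r - p)"

lemma side_top: "side r q = x (q + 1)"
  by (simp add: side_def)

text \<open>From p, a point beyond the critical point is seen in the direction of the critical point
  and may be replaced by it, whose image is 1.\<close>

lemma side_step:
  assumes "p < r"
  shows "side p q = (if q \<noteq> r \<and> x (q + 1) = x (p + 1) then side (p + 1) (q + 1) else side (p + 1) 1)"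
proof -
  have "r - p = Suc (r - (p + 1))" "r - (r - (p + 1)) = p + 1" using assms by auto
  then show ?thesis by (simp add: side_def)
qed

text \<open>Applying the cyclic map preserves both separations as long as p and s lie on the same
  side of the critical point. If they lie on opposite sides, q would have to be on the side of each.
  The induction ends when p or s is the critical point r.\<close>

lemma side_antisym:
  assumes "p \<in> {1..r}" "q \<in> {1..r}" "s \<in> {1..r}" "p \<noteq> q" "p \<noteq> s" "q \<noteq> s"
    and "side p q \<noteq> side p s"
  shows "side s q = side s p"
  using assms
proof (induction "(r - p) + (r - s)" arbitrary: p q s rule: less_induct)
  case less
  show ?case
  proof (rule ccontr)
    assume ne: "side s q \<noteq> side s p"
    consider "p = r" | "s = r" | "p < r" "s < r" using less.prems by force
    then show False
    proof cases
      case 1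
      then have "s < r" using less.prems by auto
      with 1 have "side s q = side s p"
        using less.prems(7) by (simp add: side_step side_top)
      with ne show False by simp
    next
      case 2
      then have "p < r" using less.prems by auto
      with 2 have "side p q = side p s"
        using ne by (auto simp: side_step side_top)
      with less.prems(7) show False by simp
    next
      case 3
      show False
      proof (cases "x (p + 1) = x (s + 1)")
        case True
        \<comment> \<open>The image of q, or of the critical point r when q is not on the side of
          p.\<close>
        define q' where "q' = (if q \<noteq> r \<and> x (q + 1) = x (p + 1) then q + 1 else 1)"
        have q': "q' \<in> {1..r}" "p + 1 \<noteq> q'" "q' \<noteq> s + 1"
          using less.prems r_pos by (auto simp: q'_def)
        have p: "side p q = side (p + 1) q'" "side p s = side (p + 1) (s + 1)"
          using 3 True by (simp_all add: side_step q'_def)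
        have s: "side s q = side (s + 1) q'" "side s p = side (s + 1) (p + 1)"
          using 3 True by (simp_all add: side_step q'_def)
        have "side (s + 1) q' = side (s + 1) (p + 1)"
        proof (rule less.hyps)
          show "r - (p + 1) + (r - (s + 1)) < r - p + (r - s)" using 3 by linarith
          show "side (p + 1) q' \<noteq> side (p + 1) (s + 1)" using less.prems(7) p by simp
        qed (use 3 q' less.prems in auto)
        with ne s show False by simp
      next
        case False
        have "side p s = side (p + 1) 1" "side s p = side (s + 1) 1"
          using 3 False by (simp_all add: side_step)
        with less.prems(7) ne 3 have "x (q + 1) = x (p + 1)" "x (q + 1) = x (s + 1)"
          by (auto simp: side_step split: if_splits)
        with False show False by simp
      qed
    qed
  qed
qed

text \<open>
  Read \<open>side p q \<noteq> side p s\<close> as: the point \<open>p\<close> lies between \<open>q\<close> and \<open>s\<close>. If the point \<open>1\<close> lay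
  between two others, so would every point; but points beyond a fixed one are finitely many.
\<close>

lemma side_one_const:
  assumes "a \<in> {2..r}" "b \<in> {2..r}"
  shows "side 1 a = side 1 b"
proof (rule ccontr)
  assume ne: "side 1 a \<noteq> side 1 b"
  \<comment> \<open>Separating two points passes from p to p + 1, since \<open>side_step\<close>
    expresses each value of \<open>side p\<close> as a value of \<open>side (p + 1)\<close> at
    another point.\<close>
  have sep: "\<exists>a\<in>{1..r} - {p}. \<exists>b\<in>{1..r} - {p}. side p a \<noteq> side p b" if "1 \<le> p" "p \<le> r" for p
    using that
  proof (induction p rule: nat_induct_at_least)
    case base
    have "a \<in> {1..r} - {1}" "b \<in> {1..r} - {1}" using assms by auto
    with ne show ?case by blast
  next
    case (Suc p)
    then have "p \<le> r" by simp
    then obtain a b where ab: "a \<in> {1..r} - {p}" "b \<in> {1..r} - {p}" "side p a \<noteq> side p b"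
      using Suc.IH by blast
    have "\<exists>c'\<in>{1..r} - {Suc p}. side p c = side (Suc p) c'" if "c \<in> {1..r} - {p}" for c
      using that Suc.hyps Suc.prems r_pos
      by (intro bexI[of _ "if c \<noteq> r \<and> x (c + 1) = x (p + 1) then Suc c else 1"])
        (auto simp: side_step)
    with ab show ?case by metis
  qed
  \<comment> \<open>\<open>D p\<close> consists of the points beyond p as seen from 1. For s in
    \<open>D p\<close> the set \<open>D s\<close> turns out strictly smaller, which excludes a p
    with minimal cardinality.\<close>
  define D where "D p = {u \<in> {1..r} - {p}. side p u \<noteq> side p 1}" for p
  have fin: "finite (D p)" for p by (simp add: D_def)
  obtain p where p: "p \<in> {2..r}" and min: "\<And>s. s \<in> {2..r} \<Longrightarrow> card (D p) \<le> card (D s)"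
    using ex_has_least_nat[of "\<lambda>p. p \<in> {2..r}" a "\<lambda>p. card (D p)"] assms(1) by auto
  have "1 \<le> p" "p \<le> r" using p by auto
  then obtain s where s: "s \<in> {1..r} - {p}" "side p s \<noteq> side p 1" using sep[of p] by metis
  then have sD: "s \<in> D p" by (simp add: D_def)
  have s1: "s \<in> {2..r}"
  proof -
    have "s \<noteq> 1" using s(2) by auto
    then show ?thesis using s(1) by auto
  qed
  have s_side: "side s 1 = side s p"
    using s p by (intro side_antisym) auto
  have "D s \<subseteq> D p"
  proof
    fix u assume "u \<in> D s"
    then have u: "u \<in> {1..r}" "u \<noteq> s" "side s u \<noteq> side s 1" by (auto simp: D_def)
    then have up: "u \<noteq> p" using s_side by auto
    \<comment> \<open>Antisymmetry: s lies between u and p, so p does not lie between u and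
      s.\<close>
    have "side p u = side p s"
      using u up s p s_side by (intro side_antisym) auto
    with s(2) u up show "u \<in> D p" by (simp add: D_def)
  qed
  moreover have "s \<notin> D s" by (simp add: D_def)
  ultimately have "D s \<subset> D p" using sD by blast
  then have "card (D s) < card (D p)" using fin psubset_card_mono by blast
  with min[OF s1] show False by simp
qed

section \<open>Stable sets: words whose descendants never get shorter\<close>

definition stable :: "letter list set \<Rightarrow> bool" where
  "stable B \<longleftrightarrow> (\<forall>l\<in>B. set l \<subseteq> letters \<and> \<not> cyc_reducible l \<and>
     (if odd (occ 1 l) then sec l False @ sec l True \<in> B
      else \<exists>c. length (sec l c) = length l \<and> sec l c \<in> B))"

lemma stableD:
  assumes "stable B" "l \<in> B"
  shows "set l \<subseteq> letters" "\<not> cyc_reducible l"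
    "odd (occ 1 l) \<Longrightarrow> sec l False @ sec l True \<in> B"
    "even (occ 1 l) \<Longrightarrow> \<exists>c. sec l c \<in> B \<and> length (sec l c) = length l \<and> sec l (\<not> c) = []"
proof -
  note st = assms(1)[unfolded stable_def, rule_format, OF assms(2)]
  then show "set l \<subseteq> letters" "\<not> cyc_reducible l"
    "odd (occ 1 l) \<Longrightarrow> sec l False @ sec l True \<in> B" by auto
  assume "even (occ 1 l)"
  with st obtain c where c: "length (sec l c) = length l" "sec l c \<in> B" by auto
  moreover have "sec l (\<not> c) = []" using length_sec[of l c] c by simp
  ultimately show "\<exists>c. sec l c \<in> B \<and> length (sec l c) = length l \<and> sec l (\<not> c) = []" by blast
qed

lemma occ_sec_append:
  assumes "set l \<subseteq> letters" "i \<in> {1..r}"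
  shows "occ (cyc r i) (sec l False @ sec l True) = occ i l"
  using occ_sec[OF assms(2,1), of False] by simp

lemma occ_sec_full:
  assumes "set l \<subseteq> letters" "i \<in> {1..r}" "sec l (\<not> c) = []"
  shows "occ (cyc r i) (sec l c) = occ i l"
  using occ_sec[OF assms(2,1), of c] assms(3) by simp

text \<open>Iterating \<open>path_sec\<close> moves the marked edge down to index 1. The path stays
  closed: for an odd number of letters 1 the paths of the two sections fit end to end, and for an
  even number the full section returns to its starting subtree.\<close>

lemma stable_path:
  assumes st: "stable B" and "n < r" "l \<in> B" "path (r - n) (lab n) l v v"
  shows "\<exists>l'\<in>B. \<exists>u. path 1 (lab (r - 1)) l' u u \<and> occ 1 l' = occ (r - n) l"
  using assms(2-4)
proof (induction "r - n" arbitrary: n l v rule: less_induct)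
  case less
  show ?case
  proof (cases "r - n = 1")
    case True
    then have "n = r - 1" by linarith
    with True less.prems show ?thesis by auto
  next
    case False
    define m where "m = r - n"
    have m: "1 < m" "m \<le> r" "m - 1 = r - Suc n" "cyc r m = r - Suc n" "m \<in> {1..r}" "Suc n < r"
      using False less.prems by (auto simp: m_def cyc_def)
    have h': "lab (Suc n) r = lab n 1"
      "\<And>k. 1 < k \<Longrightarrow> k \<le> r \<Longrightarrow> lab (Suc n) (k - 1) = (if x k = x m then lab n k else lab n 1)"
      by (auto simp: m_def)
    note sl = stableD[OF st less.prems(2)]
    have ps: "path (m - 1) (lab (Suc n)) (sec l c)
        (if c = x m then v else lab n 1) (if target l c = x m then v else lab n 1)" for c
      using sl(1) less.prems(3)[folded m_def] m(1,2) h' by (rule path_sec)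
    have "\<exists>l'\<in>B. \<exists>u. path (r - Suc n) (lab (Suc n)) l' u u \<and> occ (r - Suc n) l' = occ m l"
    proof (cases "odd (occ 1 l)")
      case True
      then have t: "target l c = (\<not> c)" for c by (simp add: target_eq)
      have "path (m - 1) (lab (Suc n)) (sec l False @ sec l True)
          (if False = x m then v else lab n 1) (if False = x m then v else lab n 1)"
        using ps[of False] ps[of True] unfolding path_append t
        by (cases "x m") (auto simp del: lab.simps)
      then show ?thesis
        using sl(3)[OF True] occ_sec_append[OF sl(1) m(5)] m(3,4) by metis
    next
      case False
      then obtain c where c: "sec l c \<in> B" "sec l (\<not> c) = []" using sl(4) by auto
      have "target l c = c" using False by (simp add: target_eq)
      then have "path (m - 1) (lab (Suc n)) (sec l c)
          (if c = x m then v else lab n 1) (if c = x m then v else lab n 1)"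
        using ps[of c] by (simp only:)
      then show ?thesis
        using c(1) occ_sec_full[OF sl(1) m(5) c(2)] m(3,4) by metis
    qed
    then obtain l' u where l': "l' \<in> B" "path (r - Suc n) (lab (Suc n)) l' u u"
      "occ (r - Suc n) l' = occ m l" by blast
    have "r - Suc n < r - n" using m(6) by linarith
    from less.hyps[OF this m(6) l'(1,2)] show ?thesis
      unfolding l'(3) m_def .
  qed
qed

text \<open>The full section turns the letter 1 into the edge r of a closed path on the two
  subtrees. Once this edge has moved to index 1, all loops are at one vertex by
  \<open>side_one_const\<close>, so if the edge occurred, the word reached would be cyclically
  reducible.\<close>

lemma stable_even_absent:
  assumes st: "stable B" and "l \<in> B" "even (occ 1 l)"
  shows "occ 1 l = 0"
proof (rule ccontr)
  assume pos: "occ 1 l \<noteq> 0"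
  note sl = stableD[OF assms(1,2)]
  obtain c where c: "sec l c \<in> B" "length (sec l c) = length l" "sec l (\<not> c) = []"
    using sl(4)[OF assms(3)] by blast
  have "target l c = c" using assms(3) by (simp add: target_eq)
  then have "path (r - 0) (lab 0) (sec l c) c c"
    using path_sec_first[OF sl(1) c(2)] by simp
  from stable_path[OF st r_pos c(1) this]
  obtain l' u where l': "l' \<in> B" "path 1 (lab (r - 1)) l' u u" "occ 1 l' = occ r (sec l c)"
    by auto
  have "occ r (sec l c) = occ 1 l"
    using occ_sec_full[OF sl(1) _ c(3), of 1] r_pos by (simp add: cyc_def)
  then have "occ 1 l' > 0" using pos l'(3) by simp
  moreover have "lab (r - 1) (fst a) = side 1 2" if "a \<in> set l'" "fst a \<noteq> 1" for a
  proof -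
    have "fst a \<in> {1..r}" using stableD(1)[OF st l'(1)] that by (auto simp: letters_def)
    with that(2) have "fst a \<in> {2..r}" "2 \<in> {2..r}" by auto
    from side_one_const[OF this] show ?thesis by (simp add: side_def)
  qed
  ultimately have "cyc_reducible l'"
    using l'(2) by (intro closed_path_reducible)
  with stableD(2)[OF st l'(1)] show False by simp
qed

section \<open>Letters of odd multiplicity and condition (C)\<close>

definition odd_letters :: "letter list \<Rightarrow> nat set" where
  "odd_letters l = {i \<in> {1..r}. odd (occ i l)}"

lemma odd_letters_succ:
  assumes "\<And>i. i \<in> {1..r} \<Longrightarrow> occ (cyc r i) l' = occ i l"
  shows "odd_letters l' = cyc r ` odd_letters l"
proof -
  have "cyc r ` {1..r} = {1..r}"
    using cyc_in cyc_inj by (intro endo_inj_surj) auto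
  have "i \<in> odd_letters l' \<longleftrightarrow> i \<in> cyc r ` odd_letters l" for i
  proof (cases "i \<in> {1..r}")
    case True
    then obtain j where j: "j \<in> {1..r}" "i = cyc r j" using \<open>cyc r ` {1..r} = {1..r}\<close> by blast
    have sub: "odd_letters l \<subseteq> {1..r}" by (auto simp: odd_letters_def)
    have "i \<in> cyc r ` odd_letters l \<longleftrightarrow> j \<in> odd_letters l"
      by (simp only: j(2) inj_on_image_mem_iff[OF cyc_inj j(1) sub])
    then show ?thesis using True j assms by (simp add: odd_letters_def)
  next
    case False
    then show ?thesis using cyc_in by (auto simp: odd_letters_def)
  qed
  then show ?thesis by blast
qed

text \<open>If the letter 1 has even multiplicity, one section is empty and contributes the series
  of the identity.\<close>

lemma stable_succ:
  assumes "stable B" "l \<in> B"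
  shows "\<exists>l'\<in>B. odd_letters l' = cyc r ` odd_letters l \<and>
    series l = (if 1 \<in> odd_letters l then 1 + fps_const fps_X * fps_X * series l'
      else 1 + fps_X * (series [] + series l'))"
proof (cases "odd (occ 1 l)")
  case True
  then have "1 \<in> odd_letters l" using r_pos by (simp add: odd_letters_def)
  then show ?thesis
    using stableD[OF assms] True series_odd odd_letters_succ[OF occ_sec_append] by metis
next
  case False
  then obtain c where c: "sec l c \<in> B" "sec l (\<not> c) = []" using stableD(4)[OF assms] by auto
  have "series l = 1 + fps_X * (series [] + series (sec l c))"
    using c(2) series_even[of l] False by (cases c) (simp_all add: add.commute)
  moreover have "odd_letters (sec l c) = cyc r ` odd_letters l"
    using odd_letters_succ[OF occ_sec_full[OF stableD(1)[OF assms] _ c(2)]] .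
  moreover have "1 \<notin> odd_letters l" using False by (simp add: odd_letters_def)
  ultimately show ?thesis using c(1) by auto
qed

text \<open>If 1 is not among the odd letters of a descendant, that descendant has no letter 1 at
  all, by \<open>stable_even_absent\<close>. It then stays in one subtree c, and as a full section
  loses no letter, all its letters have the value c.\<close>

lemma stable_condition_C:
  assumes st: "stable B" and "l \<in> B"
  shows "condition_C r x (odd_letters l)"
  unfolding condition_C_def
proof (intro allI impI)
  fix n
  have "\<exists>l'\<in>B. odd_letters l' = (cyc r ^^ n) ` odd_letters l"
  proof (induction n)
    case 0
    then show ?case using assms(2) by auto
  next
    case (Suc n)
    then obtain l' where l': "l' \<in> B" "odd_letters l' = (cyc r ^^ n) ` odd_letters l" by blast
    from stable_succ[OF st l'(1)] obtain l'' where "l'' \<in> B" "odd_letters l'' = cyc r ` odd_letters l'"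
      by blast
    then show ?case unfolding l'(2) by (auto simp: image_comp)
  qed
  then obtain l' where l': "l' \<in> B" "odd_letters l' = (cyc r ^^ n) ` odd_letters l" by blast
  assume "1 \<notin> (cyc r ^^ n) ` odd_letters l"
  then have "even (occ 1 l')" using l'(2) r_pos by (auto simp: odd_letters_def)
  then have occ0: "occ 1 l' = 0" and "\<exists>c. length (sec l' c) = length l'"
    using stable_even_absent[OF st l'(1)] stableD(4)[OF st l'(1)] by auto
  then obtain c where "length (sec l' c) = length l'" by blast
  then have "\<forall>a\<in>set l'. x (fst a) = c" using occ0
  proof (induction l')
    case (Cons a l')
    have "length (sec l' c) \<le> length l'" using length_sec[of l' c] by linarith
    moreover have "fst a \<noteq> 1" "turn c a = c" using Cons.prems by (auto simp: turn_def split: if_splits)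
    ultimately show ?case using Cons by (auto simp: kept_def split: if_splits)
  qed simp
  moreover have "\<exists>e. (i, e) \<in> set l'" if "i \<in> odd_letters l'" for i
    using that by (auto simp: odd_letters_def odd_pos simp flip: occ_pos_iff)
  ultimately show "\<forall>i\<in>(cyc r ^^ n) ` odd_letters l. \<forall>j\<in>(cyc r ^^ n) ` odd_letters l. x i = x j"
    unfolding l'(2)[symmetric] by (metis fst_conv)
qed

end

section \<open>The generating function of a stable word\<close>

text \<open>The numerator of \<Psi>_J, where j - 1 is the number of elements of J below the j-th. It
  is needed both for polynomials and for power series.\<close>

definition rank_sum :: "'a::comm_ring_1 \<Rightarrow> 'a \<Rightarrow> nat set \<Rightarrow> 'a" where
  "rank_sum X Y J = (\<Sum>i\<in>J. X ^ card {j \<in> J. j < i} * Y ^ i)"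

lemma cyc_inj_on: "J \<subseteq> {1..r} \<Longrightarrow> inj_on (cyc r) J"
proof (rule inj_on_subset)
  show "inj_on (cyc r) {1..r}" by (auto simp: cyc_def inj_on_def)
qed

lemma card_below_cyc:
  assumes "K \<subseteq> {2..r}" "i \<in> K"
  shows "card {j \<in> cyc r ` K. j < cyc r i} = card {j \<in> K. j < i}"
proof -
  have "{j \<in> cyc r ` K. j < cyc r i} = cyc r ` {j \<in> K. j < i}"
    using assms by (force simp: cyc_def)
  moreover have "inj_on (cyc r) {j \<in> K. j < i}"
    using assms by (intro cyc_inj_on) auto
  ultimately show ?thesis by (simp add: card_image)
qed

lemma rank_sum_cyc_no_one:
  assumes "K \<subseteq> {2..r}"
  shows "Y * rank_sum X Y (cyc r ` K) = rank_sum X Y K"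
proof -
  have "inj_on (cyc r) K" using assms by (intro cyc_inj_on) auto
  then have "rank_sum X Y (cyc r ` K) =
      (\<Sum>i\<in>K. X ^ card {j \<in> cyc r ` K. j < cyc r i} * Y ^ cyc r i)"
    unfolding rank_sum_def by (simp add: sum.reindex)
  also have "Y * \<dots> = rank_sum X Y K"
    unfolding rank_sum_def sum_distrib_left
  proof (rule sum.cong)
    fix i assume i: "i \<in> K"
    then have "Suc (cyc r i) = i" using assms by (auto simp: cyc_def)
    then have "Y ^ i = Y * Y ^ cyc r i" by (metis power_Suc)
    then show "Y * (X ^ card {j \<in> cyc r ` K. j < cyc r i} * Y ^ cyc r i) =
        X ^ card {j \<in> K. j < i} * Y ^ i"
      by (simp only: card_below_cyc[OF assms i] mult.left_commute)
  qed simp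
  finally show ?thesis .
qed

text \<open>The index 1 of lowest rank becomes r of highest rank, while every other index loses one
  in rank and one in value. With k the size of J, the correction is the term Y before the shift
  minus the term X^k Y^(r+1) after it.\<close>

lemma rank_sum_cyc_one:
  assumes J: "J \<subseteq> {1..r}" and one: "1 \<in> J"
  shows "X * Y * rank_sum X Y (cyc r ` J) = rank_sum X Y J - Y * (1 - X ^ card J * Y ^ r)"
proof -
  define K where "K = J - {1}"
  have K: "K \<subseteq> {2..r}" "finite K" "1 \<notin> K" "J = insert 1 K"
    using assms finite_subset[OF J] by (auto simp: K_def)
  then have cJ: "card J = Suc (card K)" by simp
  have "cyc r 1 = r" by (simp add: cyc_def)
  then have img: "cyc r ` J = insert r (cyc r ` K)" by (simp only: K(4) image_insert)
  have lt: "j < r" if j: "j \<in> cyc r ` K" for j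
  proof -
    obtain i where "i \<in> K" "j = cyc r i" using j by blast
    moreover from this have "2 \<le> i" "i \<le> r" using K(1) by auto
    ultimately show ?thesis by (simp add: cyc_def)
  qed
  then have notin: "r \<notin> cyc r ` K" by blast
  have ck: "card (cyc r ` K) = card K"
    using K(1) by (intro card_image cyc_inj_on) auto
  have "rank_sum X Y (cyc r ` J) = X ^ card K * Y ^ r + rank_sum X Y (cyc r ` K)"
  proof -
    have "{j \<in> insert r (cyc r ` K). j < r} = cyc r ` K" using lt by auto
    moreover have "{j \<in> insert r (cyc r ` K). j < i} = {j \<in> cyc r ` K. j < i}"
      if "i \<in> cyc r ` K" for i using lt[OF that] by auto
    ultimately show ?thesis
      unfolding rank_sum_def img using K(2) notin by (simp add: ck)
  qed
  moreover have "rank_sum X Y J = Y + X * rank_sum X Y K"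
  proof -
    have e: "{j \<in> insert 1 K. j < 1} = {}" using K(1) by auto
    have "card {j \<in> insert 1 K. j < i} = Suc (card {j \<in> K. j < i})" if "i \<in> K" for i
    proof -
      have "{j \<in> insert 1 K. j < i} = insert 1 {j \<in> K. j < i}" using that K(1) by auto
      then show ?thesis using K(2,3) by simp
    qed
    then have "(\<Sum>i\<in>K. X ^ card {j \<in> insert 1 K. j < i} * Y ^ i) = X * rank_sum X Y K"
      unfolding rank_sum_def sum_distrib_left by (intro sum.cong) (simp_all add: mult.assoc)
    moreover have "rank_sum X Y J = X ^ card {j \<in> insert 1 K. j < 1} * Y ^ 1 +
        (\<Sum>i\<in>K. X ^ card {j \<in> insert 1 K. j < i} * Y ^ i)"
      unfolding K(4) rank_sum_def using K(2,3) by (rule sum.insert)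
    ultimately show ?thesis by (simp only: e card.empty power_0 power_one_right mult_1_left)
  qed
  moreover have "Y * rank_sum X Y (cyc r ` K) = rank_sum X Y K"
    by (rule rank_sum_cyc_no_one[OF K(1)])
  ultimately show ?thesis by (simp add: cJ algebra_simps)
qed

lemma rank_sum_sorted_list:
  assumes "finite J"
  shows "(\<Sum>j = 1..card J. X ^ (j - 1) * Y ^ (sorted_list_of_set J ! (j - 1))) = rank_sum X Y J"
proof -
  define xs where "xs = sorted_list_of_set J"
  have xs: "distinct xs" "set xs = J" "length xs = card J" "sorted_wrt (<) xs"
    using assms by (simp_all add: xs_def strict_sorted_iff)
  have less: "xs ! i < xs ! k \<longleftrightarrow> i < k" if "i < length xs" "k < length xs" for i k
    using that sorted_wrt_nth_less[OF xs(4), of i k] sorted_wrt_nth_less[OF xs(4), of k i]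
    by (cases i k rule: linorder_cases) auto
  have rank: "card {j \<in> J. j < xs ! k} = k" if k: "k < length xs" for k
  proof -
    have "{j \<in> J. j < xs ! k} = (!) xs ` {..<k}"
    proof (intro equalityI subsetI)
      fix j assume "j \<in> {j \<in> J. j < xs ! k}"
      moreover from this obtain i where "i < length xs" "j = xs ! i"
        by (auto simp: xs(2)[symmetric] in_set_conv_nth)
      ultimately show "j \<in> (!) xs ` {..<k}" using k less by auto
    next
      fix j assume "j \<in> (!) xs ` {..<k}"
      then obtain i where "i < k" "j = xs ! i" by auto
      then show "j \<in> {j \<in> J. j < xs ! k}" using k less nth_mem[of i xs] by (simp add: xs(2))
    qed
    moreover have "inj_on ((!) xs) {..<k}"
      using k xs(1) by (auto simp: inj_on_def nth_eq_iff_index_eq)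
    ultimately show ?thesis by (simp add: card_image)
  qed
  have "(\<Sum>j = 1..card J. X ^ (j - 1) * Y ^ (xs ! (j - 1))) =
      (\<Sum>k<length xs. X ^ k * Y ^ (xs ! k))"
    by (rule sum.reindex_bij_witness[of _ Suc "\<lambda>j. j - 1"]) (auto simp: xs(3))
  also have "\<dots> = (\<Sum>k<length xs. X ^ card {j \<in> J. j < xs ! k} * Y ^ (xs ! k))"
    by (intro sum.cong) (simp_all add: rank)
  also have "\<dots> = rank_sum X Y J"
    unfolding rank_sum_def
    by (rule sum.reindex_bij_betw[OF bij_betw_nth]) (simp_all add: xs)
  finally show ?thesis by (simp add: xs_def)
qed

section \<open>The embedding of polynomials into power series in two variables\<close>

lemma fps_of_poly2_nth: "fps_of_poly2 P $ n = fps_of_poly (coeff P n)"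
  by (simp add: fps_of_poly2_def coeff_map_poly)

lemma fps_of_poly2_inject: "fps_of_poly2 P = fps_of_poly2 Q \<longleftrightarrow> P = Q"
proof
  assume "fps_of_poly2 P = fps_of_poly2 Q"
  then have "coeff P n = coeff Q n" for n
    by (metis fps_of_poly2_nth fps_of_poly_eq_iff)
  then show "P = Q" by (rule poly_eqI)
qed simp

lemma fps_of_poly2_1: "fps_of_poly2 1 = 1"
  by (rule fps_ext) (simp add: fps_of_poly2_nth fps_one_nth)

lemma fps_of_poly2_0: "fps_of_poly2 0 = 0"
  by (rule fps_ext) (simp add: fps_of_poly2_nth)

lemma fps_of_poly2_add: "fps_of_poly2 (P + Q) = fps_of_poly2 P + fps_of_poly2 Q"
  by (rule fps_ext) (simp add: fps_of_poly2_nth fps_of_poly_add)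

lemma fps_of_poly2_diff: "fps_of_poly2 (P - Q) = fps_of_poly2 P - fps_of_poly2 Q"
  by (rule fps_ext) (simp add: fps_of_poly2_nth fps_of_poly_diff)

lemma fps_of_poly2_mult: "fps_of_poly2 (P * Q) = fps_of_poly2 P * fps_of_poly2 Q"
  by (rule fps_ext)
    (simp add: fps_of_poly2_nth coeff_mult fps_mult_nth fps_of_poly_sum fps_of_poly_mult atLeast0AtMost)

lemma fps_of_poly2_power: "fps_of_poly2 (P ^ n) = fps_of_poly2 P ^ n"
  by (induction n) (simp_all add: fps_of_poly2_1 fps_of_poly2_mult)

lemma fps_of_poly2_sum: "fps_of_poly2 (sum f A) = (\<Sum>a\<in>A. fps_of_poly2 (f a))"
  by (induction A rule: infinite_finite_induct) (simp_all add: fps_of_poly2_0 fps_of_poly2_add)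

lemma fps_of_poly2_2: "fps_of_poly2 2 = 2"
proof -
  have "fps_of_poly2 (1 + 1) = 1 + 1" by (simp only: fps_of_poly2_add fps_of_poly2_1)
  then show ?thesis by simp
qed

lemma fps_of_poly2_varX: "fps_of_poly2 varX = fps_const fps_X"
  by (rule fps_ext) (auto simp: fps_of_poly2_nth varX_def coeff_pCons split: nat.split)

lemma fps_of_poly2_varY: "fps_of_poly2 varY = fps_X"
  by (rule fps_ext) (auto simp: fps_of_poly2_nth varY_def coeff_pCons fps_X_def split: nat.split)

lemma fps_of_poly2_rank_sum:
  "fps_of_poly2 (rank_sum varX varY J) = rank_sum (fps_const fps_X) fps_X J"
  by (simp add: rank_sum_def fps_of_poly2_sum fps_of_poly2_mult fps_of_poly2_power
      fps_of_poly2_varX fps_of_poly2_varY)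

lemmas fps_of_poly2_simps =
  fps_of_poly2_1 fps_of_poly2_2 fps_of_poly2_add fps_of_poly2_diff fps_of_poly2_mult
  fps_of_poly2_power fps_of_poly2_varX fps_of_poly2_varY fps_of_poly2_rank_sum

section \<open>Closed formula for the series\<close>

lemma defect_step_odd:
  fixes X Y q F F' N N' :: "'a::comm_ring_1"
  assumes "F = 1 + X * Y * F'" "N = X * Y * N' + Y * (1 - q)"
  shows "(1 - 2 * Y) * (1 - q) * F - (1 - q + (X - 2) * N) =
    Y * (X * ((1 - 2 * Y) * (1 - q) * F' - (1 - q + (X - 2) * N')))"
  unfolding assms by (simp add: algebra_simps)

text \<open>P stands for the series 1/(1 - 2Y) of the empty word, contributed by the empty
  section.\<close>

lemma defect_step_even:
  fixes X Y q F F' N N' P :: "'a::comm_ring_1"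
  assumes "F = 1 + Y * (P + F')" "(1 - 2 * Y) * P = 1" "N = Y * N'"
  shows "(1 - 2 * Y) * (1 - q) * F - (1 - q + (X - 2) * N) =
    Y * ((1 - 2 * Y) * (1 - q) * F' - (1 - q + (X - 2) * N'))"
proof -
  have "(1 - 2 * Y) * (1 - q) * F =
      (1 - 2 * Y) * (1 - q) + Y * (1 - q) * ((1 - 2 * Y) * P) + Y * ((1 - 2 * Y) * (1 - q) * F')"
    unfolding assms(1) by (simp add: algebra_simps)
  then show ?thesis unfolding assms(2,3) by (simp add: algebra_simps)
qed

context kneading
begin

lemma series_empty: "(1 - 2 * fps_X) * series [] = 1"
proof -
  have "series [] = 1 + fps_X * (series [] + series [])"
    using series_even[of "[]"] by simp
  then show ?thesis by (simp add: algebra_simps)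
qed

text \<open>In other words, (1 - 2Y) times the series is 1 + (X - 2) \<Psi>_J. The defect of this
  formula is Y times the defect at the successor, up to a factor X or 1, so all its coefficients
  vanish. The set \<open>S\<close> is kept abstract to serve both for stable sets and for
  \<open>series_of_set\<close>.\<close>

lemma series_formula:
  fixes S :: "(letter list \<times> nat set) set"
  defines "X \<equiv> fps_const fps_X :: fps2" and "Y \<equiv> fps_X :: fps2"
  assumes S: "\<And>l J. (l, J) \<in> S \<Longrightarrow> J \<subseteq> {1..r} \<and> (\<exists>l'. (l', cyc r ` J) \<in> S \<and>
      series l = (if 1 \<in> J then 1 + X * Y * series l' else 1 + Y * (series [] + series l')))"
    and lJ: "(l, J) \<in> S"
  shows "(1 - 2 * Y) * (1 - X ^ card J * Y ^ r) * series l =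
      1 - X ^ card J * Y ^ r + (X - 2) * rank_sum X Y J"
proof -
  define E where "E l J = (1 - 2 * Y) * (1 - X ^ card J * Y ^ r) * series l -
      (1 - X ^ card J * Y ^ r + (X - 2) * rank_sum X Y J)" for l J
  have rec: "\<exists>l' c. (l', cyc r ` J) \<in> S \<and> E l J = Y * (fps_const c * E l' (cyc r ` J))"
    if in_S: "(l, J) \<in> S" for l J
  proof -
    obtain l' where J: "J \<subseteq> {1..r}" and l': "(l', cyc r ` J) \<in> S"
      and ser: "series l = (if 1 \<in> J then 1 + X * Y * series l' else 1 + Y * (series [] + series l'))"
      using S[OF in_S] by blast
    define q where "q = X ^ card J * Y ^ r"
    have card: "card (cyc r ` J) = card J" by (rule card_image[OF cyc_inj_on[OF J]])
    define N where "N = rank_sum X Y J"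
    define N' where "N' = rank_sum X Y (cyc r ` J)"
    show ?thesis
    proof (cases "1 \<in> J")
      case True
      have "X * Y * N' = N - Y * (1 - q)"
        unfolding N_def N'_def q_def by (rule rank_sum_cyc_one[OF J True])
      then have N: "N = X * Y * N' + Y * (1 - q)" by (simp only: diff_add_cancel)
      have "series l = 1 + X * Y * series l'" using ser True by simp
      then have "E l J = Y * (X * E l' (cyc r ` J))"
        unfolding E_def card N_def[symmetric] N'_def[symmetric] q_def[symmetric]
        using N by (rule defect_step_odd)
      then show ?thesis using l' unfolding X_def by blast
    next
      case False
      have J2: "J \<subseteq> {2..r}"
      proof
        fix i assume "i \<in> J"
        moreover from this have "i \<noteq> 1" using False by blast
        ultimately show "i \<in> {2..r}" using J by fastforce
      qed
      have N: "N = Y * N'"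
        unfolding N_def N'_def by (rule rank_sum_cyc_no_one[OF J2, symmetric])
      define P where "P = series []"
      have P: "(1 - 2 * Y) * P = 1" unfolding P_def Y_def by (rule series_empty)
      have "series l = 1 + Y * (P + series l')" using ser False by (simp add: P_def)
      then have "E l J = Y * E l' (cyc r ` J)"
        unfolding E_def card N_def[symmetric] N'_def[symmetric] q_def[symmetric]
        using P N by (rule defect_step_even)
      also have "\<dots> = Y * (fps_const 1 * E l' (cyc r ` J))" by simp
      finally show ?thesis using l' by blast
    qed
  qed
  have "E l J $ n = 0" if "(l, J) \<in> S" for l J n
    using that
  proof (induction n arbitrary: l J)
    case 0
    from rec[OF this] obtain l' c where "E l J = Y * (fps_const c * E l' (cyc r ` J))" by blast
    then have "E l J $ 0 = (Y * (fps_const c * E l' (cyc r ` J))) $ 0" by (rule arg_cong)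
    then show ?case by (simp add: Y_def)
  next
    case (Suc n)
    from rec[OF Suc.prems] obtain l' c where l': "(l', cyc r ` J) \<in> S"
      and E: "E l J = Y * (fps_const c * E l' (cyc r ` J))" by blast
    have "E l J $ Suc n = (Y * (fps_const c * E l' (cyc r ` J))) $ Suc n"
      using E by (rule arg_cong)
    also have "\<dots> = c * E l' (cyc r ` J) $ n" by (simp add: Y_def)
    finally show ?case by (simp only: Suc.IH[OF l'] mult_zero_right)
  qed
  then have "E l J = 0" using lJ by (intro fps_ext) simp
  then show ?thesis by (simp add: E_def)
qed

end

section \<open>The lowest common denominator\<close>

lemma coeff_mult_at_0: "coeff (P * Q) 0 = coeff P 0 * coeff (Q :: poly2) 0"
  by (simp add: coeff_mult)

lemma coeff_prod_at_0: "coeff (prod f A) 0 = (\<Prod>a\<in>A. coeff (f a :: poly2) 0)"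
  by (induction A rule: infinite_finite_induct) (simp_all add: coeff_mult_at_0)

lemma coeff_cyc_denominator:
  assumes "r > 0"
  shows "coeff (1 - varX ^ k * varY ^ r) 0 = 1"
  using assms by (simp add: coeff_mult_at_0 varY_def coeff_0_power)

text \<open>A common divisor has degree 0 in Y and divides the constant coefficient 1 of Q.\<close>

lemma coprime_degree_0:
  fixes P Q :: poly2
  assumes "degree P = 0" "P \<noteq> 0" "coeff Q 0 = 1"
  shows "coprime P Q"
proof (rule coprimeI)
  fix c assume c: "c dvd P" "c dvd Q"
  then have "degree c = 0" using dvd_imp_degree_le[OF c(1) assms(2)] assms(1) by simp
  then obtain p where p: "c = [:p:]" by (rule degree_eq_zeroE)
  obtain R where R: "Q = c * R" using c(2) by (rule dvdE)
  have "p * coeff R 0 = 1"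
    using assms(3) unfolding R p by (simp add: coeff_mult_at_0)
  then have "p dvd 1" by (metis dvd_triv_left)
  then show "is_unit c" unfolding p by (simp add: is_unit_const_poly_iff)
qed

lemma coprime_cyc_denominators:
  assumes "r > 0" "k \<noteq> m"
  shows "coprime (1 - varX ^ k * varY ^ r) (1 - varX ^ m * varY ^ r)"
proof -
  have "coprime (1 - varX ^ k * varY ^ r) (1 - varX ^ m * varY ^ r)" if km: "k < m" for k m
  proof (rule coprimeI)
    fix c assume c: "c dvd 1 - varX ^ k * varY ^ r" "c dvd 1 - varX ^ m * varY ^ r"
    \<comment> \<open>This polynomial is the combination of the two denominators that eliminates
      Y.\<close>
    define P :: poly2 where "P = varX ^ (m - k) - 1"
    have "varX ^ m = varX ^ (m - k) * varX ^ k" using km by (simp flip: power_add)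
    then have "P = varX ^ (m - k) * (1 - varX ^ k * varY ^ r) - (1 - varX ^ m * varY ^ r)"
      by (simp add: P_def algebra_simps)
    then have "c dvd P" using c by (metis dvd_diff dvd_mult)
    have X: "varX ^ n = [:monom 1 n:]" for n
      by (induction n) (simp_all add: varX_def monom_Suc)
    have "P = [:monom 1 (m - k) - 1:]" unfolding P_def X by (simp add: one_pCons)
    moreover have "monom 1 (m - k) - 1 \<noteq> (0 :: int poly)"
    proof
      assume "monom 1 (m - k) - 1 = (0 :: int poly)"
      then have "coeff (monom 1 (m - k)) 0 = coeff (1 :: int poly) 0" by simp
      then show False using km by simp
    qed
    ultimately have "coprime P (1 - varX ^ k * varY ^ r)"
      using coeff_cyc_denominator[OF assms(1)] by (intro coprime_degree_0) simp_all
    from coprime_common_divisor[OF this \<open>c dvd P\<close> c(1)] show "is_unit c" .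
  qed
  then show ?thesis using assms(2) by (metis coprime_commute linorder_neqE_nat)
qed

text \<open>This ensures that the factor X - 2 in 1 + (X - 2) \<Psi>_J hides no part of the
  denominator of \<Psi>_J.\<close>

lemma coprime_varX_minus_2:
  assumes "r > 0"
  shows "coprime (varX - 2) (1 - varX ^ k * varY ^ r)"
proof (rule coprime_degree_0)
  have "varX - 2 = [:[:0, 1:] - 2:]"
    unfolding varX_def by (metis diff_pCons diff_zero numeral_poly)
  moreover have "[:0, 1:] - 2 \<noteq> (0 :: int poly)"
  proof
    assume "[:0, 1:] - 2 = (0 :: int poly)"
    then have "coeff [:0, 1:] 1 = coeff (2 :: int poly) 1" by simp
    then show False by (simp add: numeral_poly)
  qed
  ultimately show "degree (varX - 2) = 0" "varX - 2 \<noteq> 0" by simp_all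
qed (rule coeff_cyc_denominator[OF assms])

lemma rat_of_poly_mult_Fract:
  assumes "c \<noteq> 0"
  shows "rat_of_poly D * Fract a c \<in> range rat_of_poly \<longleftrightarrow> c dvd D * a"
  using assms by (auto simp: rat_of_poly_def eq_fract mult.commute dvd_def image_iff)

lemma is_lcd_dvd: "is_lcd S D \<Longrightarrow> E \<in> denominator_ideal S \<Longrightarrow> D dvd E"
  by (auto simp: is_lcd_def)

lemma prod_dvd_coprime:
  fixes f :: "'b \<Rightarrow> 'a::semiring_gcd"
  assumes "finite A" "\<And>a. a \<in> A \<Longrightarrow> f a dvd E"
    and "\<And>a b. a \<in> A \<Longrightarrow> b \<in> A \<Longrightarrow> a \<noteq> b \<Longrightarrow> coprime (f a) (f b)"
  shows "prod f A dvd E"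
  using assms
proof (induction A rule: finite_induct)
  case (insert a A)
  have "coprime (f a) (prod f A)"
    using insert.hyps insert.prems(2) by (intro prod_coprime_right) auto
  moreover have "f a dvd E" "prod f A dvd E" using insert by auto
  ultimately show ?case using insert.hyps by (simp add: divides_mult)
qed simp

section \<open>The polynomial D_x as a common denominator\<close>

context kneading
begin

lemma Psi_eq:
  assumes "J \<subseteq> {1..r}"
  shows "Psi r J = Fract (rank_sum varX varY J) (1 - varX ^ card J * varY ^ r)"
  using rank_sum_sorted_list[OF finite_subset[OF assms], of varX varY] by (simp add: Psi_def)

lemma cyc_denominator_nz: "1 - varX ^ k * varY ^ r \<noteq> 0"
  using coeff_cyc_denominator[OF r_pos, of k] by auto

lemma Psi_denominator:
  assumes "J \<subseteq> {1..r}"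
  shows "rat_of_poly D * Psi r J \<in> range rat_of_poly \<longleftrightarrow>
    1 - varX ^ card J * varY ^ r dvd D * rank_sum varX varY J"
  by (simp only: Psi_eq[OF assms] rat_of_poly_mult_Fract[OF cyc_denominator_nz])

lemma Dk_dvd_cyc_denominator: "Dk r x k dvd 1 - varX ^ k * varY ^ r"
proof -
  let ?S = "{Psi r J | J. J \<subseteq> {1..r} \<and> card J = k \<and> condition_C r x J}"
  have "1 - varX ^ k * varY ^ r \<in> denominator_ideal ?S"
    by (auto simp: denominator_ideal_def Psi_denominator simp del: atLeastAtMost_iff)
  then show ?thesis by (rule is_lcd_dvd[OF is_lcd_Dk[OF r_pos]])
qed

lemma Dk_cancels:
  assumes "J \<subseteq> {1..r}" "condition_C r x J"
  shows "1 - varX ^ card J * varY ^ r dvd Dk r x (card J) * rank_sum varX varY J"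
proof -
  let ?S = "{Psi r I | I. I \<subseteq> {1..r} \<and> card I = card J \<and> condition_C r x I}"
  have "Dk r x (card J) * 1 \<in> denominator_ideal ?S"
    using is_lcd_Dk[OF r_pos, where x = x and k = "card J"] unfolding is_lcd_def by blast
  moreover have "Psi r J \<in> ?S" using assms by blast
  ultimately have "rat_of_poly (Dk r x (card J)) * Psi r J \<in> range rat_of_poly"
    unfolding denominator_ideal_def mem_Collect_eq mult_1_right by blast
  then show ?thesis unfolding Psi_denominator[OF assms(1)] .
qed

lemma coeff_Dx: "coeff (Dx r x) 0 = 1"
proof -
  have "coeff (Dk r x k) 0 = 1" for k
    using is_lcd_Dk[OF r_pos, where x = x and k = k] by (simp add: is_lcd_def one_plus_Y_poly_iff)
  then show ?thesis by (simp add: Dx_def coeff_mult_at_0 coeff_prod_at_0 varY_def)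
qed

definition bounded_den :: "fps2 \<Rightarrow> bool" where
  "bounded_den F \<longleftrightarrow> (\<exists>P. fps_of_poly2 (Dx r x) * F = fps_of_poly2 P)"

lemma bounded_den_1: "bounded_den 1"
  by (auto simp: bounded_den_def)

lemma bounded_den_add:
  assumes "bounded_den F" "bounded_den G"
  shows "bounded_den (F + G)"
  using assms unfolding bounded_den_def by (metis distrib_left fps_of_poly2_add)

lemma bounded_den_mult:
  assumes "bounded_den F"
  shows "bounded_den (fps_of_poly2 Q * F)"
  using assms unfolding bounded_den_def by (metis mult.left_commute fps_of_poly2_mult)

lemma bounded_den_X: "bounded_den F \<Longrightarrow> bounded_den (fps_const fps_X * F)"
  using bounded_den_mult[of F varX] by (simp add: fps_of_poly2_varX)

lemma bounded_den_Y: "bounded_den F \<Longrightarrow> bounded_den (fps_X * F)"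
  using bounded_den_mult[of F varY] by (simp add: fps_of_poly2_varY)

lemma bounded_den_formula:
  assumes J: "J \<subseteq> {1..r}" "condition_C r x J"
    and F: "(1 - 2 * fps_X) * (1 - fps_const fps_X ^ card J * fps_X ^ r) * F =
      1 - fps_const fps_X ^ card J * fps_X ^ r + (fps_const fps_X - 2) * rank_sum (fps_const fps_X) fps_X J"
  shows "bounded_den F"
proof -
  define q where "q = 1 - varX ^ card J * varY ^ r"
  define N where "N = rank_sum varX varY J"
  define K where "K = 1 - 2 * varY"
  have F': "fps_of_poly2 K * fps_of_poly2 q * F = fps_of_poly2 (q + (varX - 2) * N)"
    using F by (simp only: K_def q_def N_def fps_of_poly2_simps)
  have "q \<noteq> 0" unfolding q_def by (rule cyc_denominator_nz)
  then have q0: "fps_of_poly2 q \<noteq> 0" by (metis fps_of_poly2_0 fps_of_poly2_inject)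
  \<comment> \<open>\<open>E\<close> is a factor of \<open>Dx r x\<close> that clears the
    denominator of \<Psi>_J. The product has no factor for J empty, but there the numerator vanishes
    and E = 1 serves.\<close>
  have "\<exists>E R P. Dx r x = K * E * R \<and> E * N = q * P"
  proof (cases "J = {}")
    case True
    then have "1 * N = q * 0" by (simp add: N_def rank_sum_def)
    moreover have "Dx r x = K * 1 * (\<Prod>k = 1..r. Dk r x k)" by (simp add: Dx_def K_def)
    ultimately show ?thesis by blast
  next
    case False
    have "finite J" using J(1) finite_subset by blast
    then have "card J \<in> {1..r}"
      using False card_mono[OF _ J(1)] by (simp add: Suc_le_eq card_gt_0_iff)
    then have "Dx r x = K * (Dk r x (card J) * (\<Prod>k\<in>{1..r} - {card J}. Dk r x k))"
      unfolding Dx_def K_def by (subst prod.remove[of _ "card J"]) simp_all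
    moreover obtain P where "Dk r x (card J) * N = q * P"
      using Dk_cancels[OF J] unfolding q_def N_def by (rule dvdE)
    ultimately show ?thesis unfolding mult.assoc by blast
  qed
  then obtain E R P where D: "Dx r x = K * E * R" and EN: "E * N = q * P" by blast
  have "fps_of_poly2 q * (fps_of_poly2 (Dx r x) * F) =
      fps_of_poly2 (E * R) * (fps_of_poly2 K * fps_of_poly2 q * F)"
    unfolding D by (simp add: fps_of_poly2_mult mult_ac)
  also have "\<dots> = fps_of_poly2 (E * R * (q + (varX - 2) * N))"
    unfolding F' by (simp only: fps_of_poly2_mult)
  also have "E * R * (q + (varX - 2) * N) = R * (E * q + (varX - 2) * (E * N))"
    by (simp add: algebra_simps)
  also have "\<dots> = q * (R * (E + (varX - 2) * P))"
    unfolding EN by (simp add: algebra_simps)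
  also have "fps_of_poly2 \<dots> = fps_of_poly2 q * fps_of_poly2 (R * (E + (varX - 2) * P))"
    by (rule fps_of_poly2_mult)
  finally have "fps_of_poly2 (Dx r x) * F = fps_of_poly2 (R * (E + (varX - 2) * P))"
    using q0 by (simp only: mult_left_cancel not_False_eq_True)
  then show ?thesis unfolding bounded_den_def by blast
qed

text \<open>The counterexamples of minimal length form a stable set: a cancellation would give a
  shorter word with the same series, and the recursion hands the common denominator on from the
  sections to the word. On a stable set, however, the closed formula holds with a set satisfying
  (C), and it bounds the denominator.\<close>

lemma bounded_den_series:
  assumes "set l \<subseteq> letters"
  shows "bounded_den (series l)"
  using assms
proof (induction "length l" arbitrary: l rule: less_induct)
  case less
  define B where "B = {l'. set l' \<subseteq> letters \<and> length l' = length l \<and> \<not> bounded_den (series l')}"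
  have "stable B"
    unfolding stable_def
  proof (intro ballI conjI)
    fix w assume "w \<in> B"
    then have w: "set w \<subseteq> letters" "length w = length l" "\<not> bounded_den (series w)"
      by (simp_all add: B_def)
    have IH: "bounded_den (series v)" if "length v < length w" "set v \<subseteq> letters" for v
      using less.hyps that w(2) by simp
    show "set w \<subseteq> letters" by (rule w(1))
    show "\<not> cyc_reducible w"
    proof
      assume "cyc_reducible w"
      from cyc_reducible_shorter[OF this] obtain v
        where "length v < length w" "set v \<subseteq> set w" "series v = series w" by blast
      with IH[of v] w show False by auto
    qed
    show "if odd (occ 1 w) then sec w False @ sec w True \<in> B
      else \<exists>c. length (sec w c) = length w \<and> sec w c \<in> B"
    proof (cases "odd (occ 1 w)")
      case True
      have "\<not> bounded_den (series (sec w False @ sec w True))"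
      proof
        assume "bounded_den (series (sec w False @ sec w True))"
        then have "bounded_den (series w)"
          unfolding series_odd[OF True] mult.assoc
          by (intro bounded_den_add bounded_den_1 bounded_den_X bounded_den_Y)
        with w(3) show False by simp
      qed
      then show ?thesis
        using True w sec_in length_sec[of w False] by (simp add: B_def)
    next
      case False
      then have ev: "even (occ 1 w)" by simp
      have "\<not> bounded_den (series (sec w False)) \<or> \<not> bounded_den (series (sec w True))"
      proof (rule ccontr)
        assume "\<not> ?thesis"
        then have "bounded_den (series w)"
          unfolding series_even[OF ev]
          by (intro bounded_den_add bounded_den_1 bounded_den_Y) simp_all
        with w(3) show False by simp
      qed
      then obtain c where c: "\<not> bounded_den (series (sec w c))" by blast
      have "length (sec w c) \<le> length w" using length_sec[of w c] by linarith
      moreover have "\<not> length (sec w c) < length w"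
        using IH[of "sec w c"] c sec_in[OF w(1)] by blast
      ultimately have "length (sec w c) = length w" by simp
      then show ?thesis using False c w sec_in by (auto simp: B_def)
    qed
  qed
  show ?case
  proof (rule ccontr)
    assume "\<not> bounded_den (series l)"
    then have l: "l \<in> B" using less.prems by (simp add: B_def)
    have sub: "odd_letters w \<subseteq> {1..r}" for w by (auto simp: odd_letters_def)
    have "bounded_den (series l)"
      using sub stable_condition_C[OF \<open>stable B\<close> l]
    proof (rule bounded_den_formula)
      show "(1 - 2 * fps_X) * (1 - fps_const fps_X ^ card (odd_letters l) * fps_X ^ r) * series l =
        1 - fps_const fps_X ^ card (odd_letters l) * fps_X ^ r +
        (fps_const fps_X - 2) * rank_sum (fps_const fps_X) fps_X (odd_letters l)"
      proof (rule series_formula)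
        show "(l, odd_letters l) \<in> {(w, odd_letters w) | w. w \<in> B}" using l by blast
        fix w J assume "(w, J) \<in> {(w, odd_letters w) | w. w \<in> B}"
        then have "w \<in> B" "J = odd_letters w" by auto
        with stable_succ[OF \<open>stable B\<close> \<open>w \<in> B\<close>] sub
        show "J \<subseteq> {1..r} \<and> (\<exists>l'. (l', cyc r ` J) \<in> {(w, odd_letters w) | w. w \<in> B} \<and>
          series w = (if 1 \<in> J then 1 + fps_const fps_X * fps_X * series l'
            else 1 + fps_X * (series [] + series l')))"
          by (metis (mono_tags, lifting) mem_Collect_eq)
      qed
    qed
    with l show False by (simp add: B_def)
  qed
qed

section \<open>Realization of every set satisfying (C)\<close>

lemma sec_avoiding:
  assumes "\<And>a. a \<in> set l \<Longrightarrow> fst a \<noteq> 1 \<and> x (fst a) = c"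
  shows "sec l (\<not> c) = []"
  using assms by (induction l) (auto simp: turn_def kept_def)

lemma condition_C_cyc:
  assumes "condition_C r x J"
  shows "condition_C r x (cyc r ` J)"
proof -
  have "(cyc r ^^ n) ` cyc r ` J = (cyc r ^^ Suc n) ` J" for n
    unfolding image_image by (rule image_cong) (simp_all add: funpow_swap1)
  then show ?thesis using assms unfolding condition_C_def by metis
qed

text \<open>The system \<open>S\<close> consists of the words that use each index of a set J
  satisfying (C) exactly once and no other index. If 1 is not in J, condition (C) puts all letters
  into one section and leaves the other empty, so \<open>S\<close> is closed under
  successors.\<close>

lemma series_of_set:
  assumes J: "J \<subseteq> {1..r}" "condition_C r x J"
    and l: "set l \<subseteq> letters" "\<And>i. i \<in> {1..r} \<Longrightarrow> occ i l = (if i \<in> J then 1 else 0)"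
  shows "(1 - 2 * fps_X) * (1 - fps_const fps_X ^ card J * fps_X ^ r) * series l =
    1 - fps_const fps_X ^ card J * fps_X ^ r +
    (fps_const fps_X - 2) * rank_sum (fps_const fps_X) fps_X J"
proof (rule series_formula)
  define S where "S = {(l, J). J \<subseteq> {1..r} \<and> condition_C r x J \<and> set l \<subseteq> letters \<and>
    (\<forall>i\<in>{1..r}. occ i l = (if i \<in> J then 1 else 0))}"
  show "(l, J) \<in> S" using assms by (simp add: S_def)
  fix l J assume "(l, J) \<in> S"
  then have J: "J \<subseteq> {1..r}" "condition_C r x J" and l: "set l \<subseteq> letters"
    and occ: "\<And>i. i \<in> {1..r} \<Longrightarrow> occ i l = (if i \<in> J then 1 else 0)"
    by (auto simp: S_def)
  have succ: "(l', cyc r ` J) \<in> S"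
    if l': "set l' \<subseteq> letters" and o: "\<And>i. i \<in> {1..r} \<Longrightarrow> occ (cyc r i) l' = occ i l" for l'
  proof -
    have surj: "cyc r ` {1..r} = {1..r}"
      using cyc_in cyc_inj by (intro endo_inj_surj) auto
    have "occ i l' = (if i \<in> cyc r ` J then 1 else 0)" if i: "i \<in> {1..r}" for i
    proof -
      obtain j where j: "j \<in> {1..r}" "i = cyc r j" using surj i by blast
      then show ?thesis
        using o[OF j(1)] occ[OF j(1)] inj_on_image_mem_iff[OF cyc_inj j(1) J(1)] by simp
    qed
    then show ?thesis
      using l' condition_C_cyc[OF J(2)] image_mono[OF J(1), of "cyc r"] surj by (simp add: S_def)
  qed
  have "\<exists>l'. (l', cyc r ` J) \<in> S \<and>
    series l = (if 1 \<in> J then 1 + fps_const fps_X * fps_X * series l'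
      else 1 + fps_X * (series [] + series l'))"
  proof (cases "1 \<in> J")
    case True
    then have odd: "odd (occ 1 l)" using occ[of 1] r_pos by simp
    have "(sec l False @ sec l True, cyc r ` J) \<in> S"
      using sec_in[OF l] by (intro succ occ_sec_append[OF l]) simp
    moreover have "series l = (if 1 \<in> J then
        1 + fps_const fps_X * fps_X * series (sec l False @ sec l True) else
        1 + fps_X * (series [] + series (sec l False @ sec l True)))"
      unfolding if_P[OF True] by (rule series_odd[OF odd])
    ultimately show ?thesis by (intro exI conjI)
  next
    case False
    then have o1: "occ 1 l = 0" using occ[of 1] r_pos by simp
    have in_J: "fst a \<in> J" if "a \<in> set l" for a
    proof -
      have "fst a \<in> {1..r}" using that l by (auto simp: letters_def)
      moreover have "occ (fst a) l > 0" using that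
        unfolding occ_pos_iff by (intro exI[of _ "snd a"]) simp
      ultimately show ?thesis using occ[of "fst a"] by (auto split: if_splits)
    qed
    obtain c where c: "\<And>i. i \<in> J \<Longrightarrow> x i = c"
    proof (cases "J = {}")
      case True
      show ?thesis by (rule that[of True]) (simp add: True)
    next
      case False
      then obtain j where j: "j \<in> J" by blast
      have id: "(cyc r ^^ 0) ` J = J" by simp
      have "\<forall>i\<in>J. \<forall>j\<in>J. x i = x j"
        using spec[OF J(2)[unfolded condition_C_def], of 0] \<open>1 \<notin> J\<close> unfolding id by (rule mp)
      with j show ?thesis by (intro that[of "x j"]) blast
    qed
    have nil: "sec l (\<not> c) = []"
    proof (rule sec_avoiding)
      fix a assume "a \<in> set l"
      then have "fst a \<in> J" by (rule in_J)
      then show "fst a \<noteq> 1 \<and> x (fst a) = c" using c[of "fst a"] False by metis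
    qed
    have "(sec l c, cyc r ` J) \<in> S"
      using sec_in[OF l] occ_sec_full[OF l _ nil] by (rule succ)
    moreover have "series l = (if 1 \<in> J then 1 + fps_const fps_X * fps_X * series (sec l c)
        else 1 + fps_X * (series [] + series (sec l c)))"
      unfolding if_not_P[OF False]
      using nil series_even[of l] o1 by (cases c) (simp_all add: add.commute)
    ultimately show ?thesis by (intro exI conjI)
  qed
  then show "J \<subseteq> {1..r} \<and> (\<exists>l'. (l', cyc r ` J) \<in> S \<and>
    series l = (if 1 \<in> J then 1 + fps_const fps_X * fps_X * series l'
      else 1 + fps_X * (series [] + series l')))"
    by (intro conjI J(1))
qed

definition set_word :: "nat set \<Rightarrow> letter list" where
  "set_word J = map (\<lambda>i. (i, True)) (sorted_list_of_set J)"

lemma set_word: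
  assumes "J \<subseteq> {1..r}"
  shows "set (set_word J) \<subseteq> letters"
    "occ i (set_word J) = (if i \<in> J then 1 else 0)"
proof -
  have fin: "finite J" using assms finite_subset by blast
  then show "set (set_word J) \<subseteq> letters"
    using assms by (auto simp: set_word_def letters_def)
  have "distinct xs \<Longrightarrow> occ i (map (\<lambda>i. (i, True)) xs) = (if i \<in> set xs then 1 else 0)" for xs
    by (induction xs) auto
  then show "occ i (set_word J) = (if i \<in> J then 1 else 0)"
    using fin by (simp add: set_word_def)
qed

section \<open>From words back to the group, with the reversal of tree words undone\<close>

definition tree_run :: "letter list \<Rightarrow> word \<Rightarrow> word" where
  "tree_run l = rev \<circ> run l \<circ> rev"

lemma Phi_tree_run: "Phi (tree_run l) = series l"
  unfolding series_def
proof (rule Phi_conj[of rev])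
  show "\<exists>s. t = rev s" for t :: word by (metis rev_rev_ident)
qed (simp_all add: tree_run_def)

lemma tree_run_append: "tree_run (l @ l') = tree_run l' \<circ> tree_run l"
  by (simp add: tree_run_def fun_eq_iff run_append)

lemma act_True: "act s (i, True) = rev_gen r x s i"
  by (induction s arbitrary: i) (auto simp: turn_def kept_def shift_def cyc_def)

lemma tree_run_generator: "tree_run [(i, True)] = tree_gen r x i"
  by (simp add: tree_run_def tree_gen_def fun_eq_iff act_True)

lemma tree_run_inverse: "inv\<^bsub>AutT\<^esub> (tree_gen r x i) = tree_run [(i, False)]"
proof -
  let ?g = "inv\<^bsub>AutT\<^esub> (tree_gen r x i)"
  have "?g \<otimes>\<^bsub>AutT\<^esub> tree_gen r x i = \<one>\<^bsub>AutT\<^esub>"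
    by (rule group.l_inv[OF group_AutT tree_gen_in_AutT])
  then have g: "?g \<circ> tree_run [(i, True)] = id" by (simp add: AutT_def tree_run_generator)
  have e: "tree_run [(i, True)] \<circ> tree_run [(i, False)] = id"
    using act_inv[of _ "(i, False)"] by (simp add: tree_run_def fun_eq_iff inv_letter_def)
  have "?g = ?g \<circ> (tree_run [(i, True)] \<circ> tree_run [(i, False)])" by (simp add: e)
  also have "\<dots> = tree_run [(i, False)]" by (simp only: comp_assoc[symmetric] g id_comp)
  finally show ?thesis .
qed

lemma Gamma_eq:
  assumes "recursion_relations r x b"
  shows "Gamma r b = tree_run ` {l. set l \<subseteq> letters}"
proof (intro equalityI subsetI)
  note b = recursion_relations_unique[OF assms]
  fix w assume "w \<in> Gamma r b"
  then show "w \<in> tree_run ` {l. set l \<subseteq> letters}"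
    unfolding Gamma_def
  proof (induction rule: generate.induct)
    case one
    have "tree_run [] = \<one>\<^bsub>AutT\<^esub>" by (simp add: tree_run_def AutT_def fun_eq_iff)
    then show ?case by (intro image_eqI[of _ _ "[]"]) simp_all
  next
    case (incl h)
    then obtain i where i: "i \<in> {1..r}" "h = b i" by blast
    then have "h = tree_run [(i, True)]" by (simp only: b tree_run_generator)
    then show ?case using i(1) by (intro image_eqI[of _ _ "[(i, True)]"]) (simp_all add: letters_def)
  next
    case (inv h)
    then obtain i where i: "i \<in> {1..r}" "h = b i" by blast
    then have "inv\<^bsub>AutT\<^esub> h = tree_run [(i, False)]" by (simp only: b tree_run_inverse)
    then show ?case using i(1) by (intro image_eqI[of _ _ "[(i, False)]"]) (simp_all add: letters_def)
  next
    case (eng h1 h2)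
    then obtain l1 l2 where l: "set l1 \<subseteq> letters" "set l2 \<subseteq> letters"
      "h1 = tree_run l1" "h2 = tree_run l2" by blast
    \<comment> \<open>In a list the first letter acts first, whereas products are compositions, so
      the words are concatenated in the opposite order.\<close>
    then have "h1 \<otimes>\<^bsub>AutT\<^esub> h2 = tree_run (l2 @ l1)" by (simp add: AutT_def tree_run_append)
    then show ?case using l by (intro image_eqI[of _ _ "l2 @ l1"]) simp_all
  qed
next
  note b = recursion_relations_unique[OF assms]
  fix w assume "w \<in> tree_run ` {l. set l \<subseteq> letters}"
  then obtain l where w: "w = tree_run l" and "set l \<subseteq> letters" by blast
  from \<open>set l \<subseteq> letters\<close> have "tree_run l \<in> generate AutT (b ` {1..r})"
  proof (induction l)
    case Nil
    have "tree_run [] = \<one>\<^bsub>AutT\<^esub>" by (simp add: tree_run_def AutT_def fun_eq_iff)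
    then show ?case using generate.one by metis
  next
    case (Cons a l)
    obtain i e where a: "a = (i, e)" by (cases a)
    then have i: "i \<in> {1..r}" using Cons.prems by (auto simp: letters_def)
    then have bi: "b i \<in> b ` {1..r}" by blast
    have "tree_run [a] = (if e then b i else inv\<^bsub>AutT\<^esub> (b i))"
      by (simp add: a b[OF i] tree_run_generator tree_run_inverse)
    then have "tree_run [a] \<in> generate AutT (b ` {1..r})"
      using generate.incl[OF bi, of AutT] generate.inv[OF bi, of AutT] by (cases e) simp_all
    moreover have "tree_run l \<in> generate AutT (b ` {1..r})" using Cons by simp
    ultimately have "tree_run l \<otimes>\<^bsub>AutT\<^esub> tree_run [a] \<in> generate AutT (b ` {1..r})"
      by (intro generate.eng)
    moreover have "tree_run (a # l) = tree_run l \<circ> tree_run [a]"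
      using tree_run_append[of "[a]" l] by (simp only: append.simps)
    then have "tree_run (a # l) = tree_run l \<otimes>\<^bsub>AutT\<^esub> tree_run [a]"
      by (simp add: AutT_def)
    ultimately show ?case by (simp only:)
  qed
  then show "w \<in> Gamma r b" by (simp add: Gamma_def w)
qed

text \<open>One inclusion is \<open>bounded_den_series\<close>. For the other, the empty word forces
  the factor 1 - 2Y, and the words realizing the sets J force every D_k into the remaining
  cofactor.\<close>

lemma lcd_series:
  assumes "recursion_relations r x b"
  shows "is_lcd {f. \<exists>w\<in>Gamma r b. is_rational (Phi w) f} (Dx r x)" (is "is_lcd ?S _")
  unfolding is_lcd_def
proof
  show "Dx r x \<in> one_plus_Y_poly" by (simp add: one_plus_Y_poly_iff coeff_Dx)
  have S: "f \<in> ?S \<longleftrightarrow> (\<exists>l. set l \<subseteq> letters \<and> is_rational (series l) f)" for f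
    unfolding Gamma_eq[OF assms] by (auto simp: Phi_tree_run)
  show "denominator_ideal ?S = {Dx r x * Q | Q. True}"
  proof (intro equalityI subsetI)
    fix E assume "E \<in> {Dx r x * Q | Q. True}"
    then obtain Q where E: "E = Dx r x * Q" by blast
    have "rat_of_poly E * f \<in> range rat_of_poly" if f: "f \<in> ?S" for f
    proof -
      obtain l where l: "set l \<subseteq> letters" "is_rational (series l) f"
        using f unfolding S by blast
      then obtain N D where ND: "D \<noteq> 0" "f = Fract N D"
        "fps_of_poly2 D * series l = fps_of_poly2 N" unfolding is_rational_def by blast
      obtain P where P: "fps_of_poly2 (Dx r x) * series l = fps_of_poly2 P"
        using bounded_den_series[OF l(1)] unfolding bounded_den_def by blast
      have "fps_of_poly2 (D * P) = fps_of_poly2 (Dx r x * N)"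
        unfolding fps_of_poly2_mult P[symmetric] ND(3)[symmetric] by (rule mult.left_commute)
      then have DP: "D * P = Dx r x * N" by (simp only: fps_of_poly2_inject)
      have "E * N = Dx r x * N * Q" unfolding E by (simp only: mult_ac)
      then have "E * N = D * (P * Q)" by (simp only: DP[symmetric] mult.assoc)
      then have "D dvd E * N" by (rule dvdI)
      then show ?thesis unfolding ND(2) rat_of_poly_mult_Fract[OF ND(1)] .
    qed
    then show "E \<in> denominator_ideal ?S" unfolding denominator_ideal_def by blast
  next
    fix E assume E: "E \<in> denominator_ideal ?S"
    have dvd: "D dvd E * N"
      if "D \<noteq> 0" "set l \<subseteq> letters" "fps_of_poly2 D * series l = fps_of_poly2 N" for D N l
    proof -
      have "is_rational (series l) (Fract N D)"
        unfolding is_rational_def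
        by (intro exI[of _ N] exI[of _ D] conjI refl that(1,3))
      then have "Fract N D \<in> ?S" unfolding S using that(2) by blast
      then have "rat_of_poly E * Fract N D \<in> range rat_of_poly"
        using E unfolding denominator_ideal_def by blast
      then show ?thesis by (simp only: rat_of_poly_mult_Fract[OF that(1)])
    qed
    define K where "K = 1 - 2 * varY"
    have "coeff K 0 = 1" by (simp add: K_def coeff_mult_at_0 varY_def)
    then have K0: "K \<noteq> 0" by auto
    have "fps_of_poly2 K * series [] = fps_of_poly2 1"
      unfolding K_def by (simp only: fps_of_poly2_simps series_empty)
    from dvd[OF K0 _ this] have "K dvd E" by simp
    then obtain E' where E': "E = K * E'" by (rule dvdE)
    have "Dk r x k dvd E'" for k
    proof -
      have "rat_of_poly E' * Psi r J \<in> range rat_of_poly"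
        if J: "J \<subseteq> {1..r}" "card J = k" "condition_C r x J" for J
      proof -
        define q where "q = 1 - varX ^ card J * varY ^ r"
        define N where "N = rank_sum varX varY J"
        have "fps_of_poly2 (K * q) * series (set_word J) = fps_of_poly2 (q + (varX - 2) * N)"
          using series_of_set[OF J(1,3) set_word[OF J(1)]]
          unfolding K_def q_def N_def fps_of_poly2_simps .
        moreover have q0: "q \<noteq> 0" unfolding q_def by (rule cyc_denominator_nz)
        moreover have "K * q \<noteq> 0" using K0 q0 by simp
        ultimately have "K * q dvd E * (q + (varX - 2) * N)"
          using dvd set_word(1)[OF J(1)] by blast
        then have "K * q dvd K * (E' * (q + (varX - 2) * N))"
          by (simp only: E' mult.assoc)
        \<comment> \<open>Here \<open>q\<close> divides the first summand and is coprime to X - 2,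
          which isolates the numerator of \<Psi>_J.\<close>
        then have "q dvd E' * (q + (varX - 2) * N)"
          by (simp only: dvd_times_left_cancel_iff[OF K0])
        moreover have "E' * (q + (varX - 2) * N) = q * E' + (varX - 2) * (E' * N)"
          by (simp add: distrib_left mult_ac)
        ultimately have "q dvd (varX - 2) * (E' * N)"
          by (simp only: dvd_add_right_iff[OF dvd_triv_left])
        moreover have "coprime q (varX - 2)"
          unfolding q_def using coprime_varX_minus_2[OF r_pos] coprime_commute by blast
        ultimately have "q dvd E' * N" by (simp only: coprime_dvd_mult_right_iff)
        then show ?thesis unfolding Psi_denominator[OF J(1)] q_def N_def .
      qed
      then have "E' \<in> denominator_ideal {Psi r J | J. J \<subseteq> {1..r} \<and> card J = k \<and> condition_C r x J}"
        unfolding denominator_ideal_def by blast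
      then show ?thesis
        by (rule is_lcd_dvd[OF is_lcd_Dk[OF r_pos]])
    qed
    \<comment> \<open>Each D_k divides 1 - X^k Y^r, and these are pairwise coprime, so the separate
      divisibilities combine to that by the product.\<close>
    moreover have "coprime (Dk r x k) (Dk r x m)" if "k \<noteq> m" for k m
      using coprime_divisors[OF Dk_dvd_cyc_denominator Dk_dvd_cyc_denominator
          coprime_cyc_denominators[OF r_pos that]] .
    ultimately have "(\<Prod>k = 1..r. Dk r x k) dvd E'" by (intro prod_dvd_coprime) simp_all
    then have "Dx r x dvd E" unfolding Dx_def E' K_def by (rule mult_dvd_mono[OF dvd_refl])
    then show "E \<in> {Dx r x * Q | Q. True}" by (auto elim: dvdE)
  qed
qed

end

theorem theorem4p46:
  fixes r :: nat and x :: "nat \<Rightarrow> bool" and b :: "nat \<Rightarrow> word \<Rightarrow> word"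
  assumes "r > 0" and "recursion_relations r x b"
  shows "(\<forall>w\<in>Gamma r b. Phi w \<in> one_plus_Y_fps \<and> (\<exists>f. is_rational (Phi w) f)) \<and>
         is_lcd {f. \<exists>w\<in>Gamma r b. is_rational (Phi w) f} (Dx r x)"
proof -
  interpret kneading r x by standard (rule assms(1))
  have "Phi w \<in> one_plus_Y_fps \<and> (\<exists>f. is_rational (Phi w) f)" if w: "w \<in> Gamma r b" for w
  proof
    obtain l where l: "set l \<subseteq> letters" and Phi: "Phi w = series l"
      using w unfolding Gamma_eq[OF assms(2)] by (auto simp: Phi_tree_run)
    have "series l = 1 + fps_X * fps_shift 1 (series l)"
    proof (rule fps_ext)
      show "series l $ n = (1 + fps_X * fps_shift 1 (series l)) $ n" for n
        by (cases n) (simp_all add: series_nth_0)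
    qed
    then show "Phi w \<in> one_plus_Y_fps" unfolding Phi one_plus_Y_fps_def by blast
    obtain P where "fps_of_poly2 (Dx r x) * series l = fps_of_poly2 P"
      using bounded_den_series[OF l] unfolding bounded_den_def by blast
    moreover have "Dx r x \<noteq> 0" using coeff_Dx by auto
    ultimately show "\<exists>f. is_rational (Phi w) f" unfolding Phi is_rational_def by blast
  qed
  with lcd_series[OF assms(2)] show ?thesis by blast
qed

end
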